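(* Let $G$ be a finite group. If $1<\lambda(G)<\frac52$, then $$\lambda(G)\in\left\{\frac32,\ 2,\ \frac94\right\}.$$ All three values occur, i.e. each of them equals $\lambda(G)$ for some finite group $G$.
   Context: For a finite group $G$, $\mathrm{sub}(G)$ denotes the number of subgroups of $G$ (including the trivial subgroup and $G$), $\pi(G)$ denotes the number of distinct prime divisors of $|G|$ (so $\pi(1)=0$), and $\lambda(G)=\mathrm{sub}(G)/2^{\pi(G)}$. *)

theory Defs
  imports "HOL-Algebra.Coset" "HOL-Computational_Algebra.Primes" Complex_Main
begin

definition num_subgroups :: "('a, 'b) monoid_scheme \<Rightarrow> nat" where
  "num_subgroups G = card {H. subgroup H G}"

definition num_primes :: "('a, 'b) monoid_scheme \<Rightarrow> nat" where
  "num_primes G = card (prime_factors (order G))"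

definition subgroup_ratio :: "('a, 'b) monoid_scheme \<Rightarrow> real" where
  "subgroup_ratio G = real (num_subgroups G) / 2 ^ num_primes G"

end

theory Submission
  imports Defs "HOL-Algebra.Multiplicative_Group" "HOL-Algebra.Elementary_Groups"
    "HOL-Algebra.Group_Action" "HOL-Algebra.Sylow" "HOL-Algebra.SndIsomorphismGrp"
begin

text \<open>
  By strong induction every finite group \<open>G\<close> is tame: \<open>\<lambda>(G)\<close> is 1 (and then \<open>G\<close> is cyclic), or one of
  \<open>3/2\<close>, 2, \<open>9/4\<close>, or at least \<open>5/2\<close>; this set of values is closed under coprime direct products.
  For a prime \<open>p\<close> let \<open>i\<close> be the number of Sylow \<open>p\<close>-subgroups \<open>P\<close>, and \<open>M\<close> the set of primes dividing
  \<open>|G|\<close> but not \<open>|N(P)|\<close>. The subgroups \<open>H\<close> with \<open>P \<le> H \<le> N(P)\<close> for some \<open>P\<close> correspond to the subgroups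
  of the \<open>i\<close> quotients \<open>N(P)/P\<close>, so by induction there are at least \<open>i 2^(\<pi>(G)-1-|M|)\<close> of them. If \<open>i > 1\<close>,
  then \<open>i\<close> may be improved to \<open>i + 1\<close> here by counting subgroups whose order is prime to \<open>p\<close> and \<open>M\<close>:
  either all quotients have ratio at least \<open>3/2\<close>, or one is cyclic and so lifts to a complement of \<open>P\<close>.
  The families belonging to \<open>p\<close> and to a prime in \<open>M\<close> are disjoint. As \<open>\<Prod>M\<close> divides \<open>i\<close> and
  \<open>i \<equiv> 1\<close> modulo \<open>p\<close>, a ratio below \<open>5/2\<close> leaves only \<open>(M, i, p) = ({}, 3, 2), ({2}, 4, 3), ({3}, 3, 2)\<close> or
  \<open>({5}, 5, 2)\<close>, with all other Sylow subgroups normal. A Sylow subgroup for a prime not dividing \<open>i\<close> is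
  then a direct factor; what remains has at most two prime divisors.
\<close>

section \<open>Isomorphisms, subgroups and quotients\<close>

text \<open>The bound 5/2 is attained by cyclic groups of order p^4, by the dihedral group of order
  14 and by A4, so the estimates have little slack. This is why i has to become i + 1: with i alone,
  (M, i, p) = ({}, 4, 3) and ({7}, 7, 2), for example, would survive. The additional 1 needs a
  complement of P, in general a matter of Schur-Zassenhaus; carrying cyclicity along with ratio 1
  makes an elementary lift of a generator enough. Counting alone still leaves triples such as ({2},
  6, 5) or ({2, 3, 5}, 30, 29). For these, suppose that q in M has a normal Sylow subgroup Q. Then P
  acts on Q fixing only the identity, so |Q| is 1 modulo p; it also divides i. In these triples that
  forces |Q| = i, although i is not a prime power. So q has nonnormal Sylow subgroups too, and its
  family contributes at least 3/4 to the ratio instead of 1/2, which nearly always suffices. With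
  two prime divisors the ratio is a multiple of 1/4, and the value that takes real work to exclude
  is 7/4, that is, 7 subgroups.\<close>

lemma num_subgroups_iso:
  assumes "G \<cong> H" "group G" "group H"
  shows "num_subgroups G = num_subgroups H"
proof -
  obtain f where f: "f \<in> iso G H" using assms(1) by (auto simp: is_iso_def)
  define g where "g = inv_into (carrier G) f"
  have g: "g \<in> iso H G" unfolding g_def using f assms(2) by (rule group.iso_set_sym[rotated])
  have bij: "bij_betw f (carrier G) (carrier H)" using f by (simp add: iso_def)
  have "bij_betw ((`) f) {K. subgroup K G} {K. subgroup K H}"
  proof (rule bij_betw_byWitness[where f' = "(`) g"])
    show "\<forall>K\<in>{K. subgroup K G}. g ` f ` K = K"
      unfolding g_def
      by (metis bij bij_betw_imp_inj_on inv_into_image_cancel mem_Collect_eq subgroup.subset)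
    show "\<forall>K\<in>{K. subgroup K H}. f ` g ` K = K"
      unfolding g_def
      by (metis bij bij_betw_imp_surj_on image_inv_into_cancel mem_Collect_eq subgroup.subset)
    show "(`) f ` {K. subgroup K G} \<subseteq> {K. subgroup K H}"
      using f assms by (auto intro: subgroup.iso_subgroup)
    show "(`) g ` {K. subgroup K H} \<subseteq> {K. subgroup K G}"
      using g assms by (auto intro: subgroup.iso_subgroup)
  qed
  thus ?thesis unfolding num_subgroups_def by (rule bij_betw_same_card)
qed

lemma subgroup_ratio_iso:
  assumes "G \<cong> H" "group G" "group H"
  shows "subgroup_ratio G = subgroup_ratio H"
  using num_subgroups_iso[OF assms] iso_same_card[OF assms(1)]
  by (simp add: subgroup_ratio_def num_primes_def order_def)

text \<open>The induction has to stay at one type, whereas a quotient of a subgroup of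
  \<open>G\<close> has sets of elements of \<open>G\<close> as its elements. Copies on the naturals
  bring all these groups under one induction hypothesis.\<close>

lemma finite_group_iso_nat:
  fixes G :: "('a, 'b) monoid_scheme"
  assumes "group G" "finite (carrier G)"
  obtains K :: "nat monoid" where "group K" "finite (carrier K)" "G \<cong> K"
proof -
  interpret group G by fact
  obtain f where f: "bij_betw f (carrier G) {0..<card (carrier G)}"
    using assms(2) ex_bij_betw_finite_nat by blast
  define g where "g = inv_into (carrier G) f"
  have gf: "g (f x) = x" if "x \<in> carrier G" for x
    using f that by (simp add: g_def bij_betw_inv_into_left)
  define K where "K = \<lparr>carrier = f ` carrier G, monoid.mult = (\<lambda>x y. f (g x \<otimes>\<^bsub>G\<^esub> g y)), one = f \<one>\<^bsub>G\<^esub>\<rparr>"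
  have "monoid K"
    by (rule monoidI) (auto simp: K_def gf m_assoc)
  have "f \<in> iso G K"
    using f by (auto simp: iso_def hom_def K_def gf bij_betw_def)
  hence iso: "G \<cong> K" by (auto simp: is_iso_def)
  show thesis
    using that[of K] iso iso_imp_group[OF iso \<open>monoid K\<close>] assms(2) by (simp add: K_def)
qed

text \<open>Cyclicity is recorded with ratio 1 because it is what lifts a quotient to a complement.
  The lower bound 1 for every ratio is itself part of the claim proved by induction.\<close>

definition tame :: "('a, 'b) monoid_scheme \<Rightarrow> bool" where
  "tame G \<longleftrightarrow> subgroup_ratio G = 1 \<and> cyclic_group G
     \<or> subgroup_ratio G \<in> {3 / 2, 2, 9 / 4} \<or> 5 / 2 \<le> subgroup_ratio G"

lemma tame_iso:
  assumes "G \<cong> H" "group G" "group H" "tame H"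
  shows "tame G"
  using assms subgroup_ratio_iso[OF assms(1-3)] isomorphic_group_cyclicity[OF assms(1-3)]
  by (simp add: tame_def)

lemma tame_ge_1: "tame G \<Longrightarrow> 1 \<le> subgroup_ratio G"
  by (auto simp: tame_def)

lemma (in group) subgroups_of_subgroup:
  assumes "subgroup H G"
  shows "{K. subgroup K (G\<lparr>carrier := H\<rparr>)} = {K. subgroup K G \<and> K \<subseteq> H}"
proof safe
  fix K assume K: "subgroup K (G\<lparr>carrier := H\<rparr>)"
  show "subgroup K G" using incl_subgroup[OF assms K] .
  show "x \<in> H" if "x \<in> K" for x using subgroup.subset[OF K] that by auto
next
  fix K assume K: "subgroup K G" "K \<subseteq> H"
  show "subgroup K (G\<lparr>carrier := H\<rparr>)" using subgroup_incl[OF K(1) assms K(2)] .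
qed

text \<open>The correspondence theorem: \<open>K\<close> goes to the set of its cosets, and a
  subgroup of the quotient goes back to the union of its cosets.\<close>

lemma (in normal) num_subgroups_Mod:
  "num_subgroups (G Mod H) = card {K. subgroup K G \<and> H \<subseteq> K}"
proof -
  have "bij_betw (\<lambda>K. (\<lambda>x. H #> x) ` K) {K. subgroup K G \<and> H \<subseteq> K} {A. subgroup A (G Mod H)}"
  proof (rule bij_betw_byWitness[where f' = Union])
    show "\<forall>K\<in>{K. subgroup K G \<and> H \<subseteq> K}. \<Union> ((#>) H ` K) = K"
    proof safe
      fix K x y assume K: "subgroup K G" "H \<subseteq> K" and "y \<in> K" "x \<in> H #> y"
      thus "x \<in> K" by (auto simp: r_coset_def subgroup.m_closed)
    next
      fix K x assume K: "subgroup K G" "H \<subseteq> K" and x: "x \<in> K"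
      have "x \<in> H #> x" using rcos_self[OF subgroup.mem_carrier[OF K(1) x] subgroup_axioms] .
      thus "x \<in> \<Union> ((#>) H ` K)" using x by blast
    qed
    show un: "\<forall>A\<in>{A. subgroup A (G Mod H)}. (#>) H ` (\<Union> A) = A"
    proof safe
      fix A x X assume A: "subgroup A (G Mod H)" and "x \<in> X" "X \<in> A"
      thus "H #> x \<in> A" using factgroup_subgroup_union_char[OF A] by blast
    next
      fix A X assume A: "subgroup A (G Mod H)" "X \<in> A"
      hence "X \<in> carrier (G Mod H)" using subgroup.mem_carrier by fastforce
      then obtain x where x: "x \<in> carrier G" "X = H #> x" by (auto simp: carrier_FactGroup)
      thus "X \<in> (#>) H ` \<Union> A"
        using A factgroup_subgroup_union_char[OF A(1)] by blast
    qed
    show "(`) ((#>) H) ` {K. subgroup K G \<and> H \<subseteq> K} \<subseteq> {A. subgroup A (G Mod H)}"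
    proof safe
      fix K assume K: "subgroup K G" "H \<subseteq> K"
      have "subgroup (rcosets\<^bsub>G\<lparr>carrier := K\<rparr>\<^esub> H) (G Mod H)"
        using normal_subgroup_factorize[OF normal_axioms K(2,1)] .
      moreover have "rcosets\<^bsub>G\<lparr>carrier := K\<rparr>\<^esub> H = (#>) H ` K"
        by (auto simp: RCOSETS_def r_coset_def)
      ultimately show "subgroup ((#>) H ` K) (G Mod H)" by simp
    qed
    show "Union ` {A. subgroup A (G Mod H)} \<subseteq> {K. subgroup K G \<and> H \<subseteq> K}"
    proof safe
      fix A assume A: "subgroup A (G Mod H)"
      show "subgroup (\<Union> A) G" using factgroup_subgroup_union_subgroup[OF A] .
      fix x assume x: "x \<in> H"
      have "H \<in> A" using subgroup.one_closed[OF A] by simp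
      thus "x \<in> \<Union> A" using x by blast
    qed
  qed
  from bij_betw_same_card[OF this] show ?thesis by (simp add: num_subgroups_def)
qed

text \<open>Bezout writes \<open>x\<close> as a product of powers of x^a and x^b. This serves below
  for trivial intersections, for absorption into a normal subgroup and for separating commuting
  factors.\<close>

lemma (in group) pow_coprime_mem:
  assumes H: "subgroup H G" and x: "x \<in> carrier G" and "x [^] (a::nat) \<in> H" "x [^] (b::nat) \<in> H" "coprime a b"
  shows "x \<in> H"
proof -
  obtain u v where uv: "u * int a + v * int b = 1"
    using bezout_int[of "int a" "int b"] assms(5) by (metis coprime_imp_gcd_eq_1 coprime_int_iff)
  have pow: "x [^] (w * int c) \<in> H" if "x [^] c \<in> H" for c :: nat and w :: int
  proof -
    have "x [^] (w * int c) = (x [^] c) [^] w"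
      using x by (metis int_pow_int int_pow_pow mult.commute)
    thus ?thesis using subgroup_int_pow_closed[OF H that] by simp
  qed
  have "x [^] (u * int a) \<otimes> x [^] (v * int b) = x"
    using x by (simp add: uv flip: int_pow_mult)
  thus ?thesis using subgroup.m_closed[OF H pow[OF assms(3)] pow[OF assms(4)]] by metis
qed

lemma (in normal) order_Mod: "order (G Mod H) * card H = order G"
  using lagrange[OF is_subgroup] by (simp add: order_def FactGroup_def)

lemma (in normal) pow_index_mem:
  assumes "finite (carrier G)" "x \<in> carrier G"
  shows "x [^] (order G div card H) \<in> H"
proof -
  have "card H > 0" using assms(1) by (rule finite_imp_card_positive)
  hence "order (G Mod H) = order G div card H" by (simp flip: order_Mod)
  moreover have "(H #> x) [^]\<^bsub>G Mod H\<^esub> order (G Mod H) = H"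
    using group.pow_order_eq_1[OF factorgroup_is_group, of "H #> x"] assms
    by (simp add: carrier_FactGroup)
  ultimately have "H #> (x [^] (order G div card H)) = H"
    using FactGroup_pow assms(2) by simp
  thus ?thesis
    using assms(2) by (metis is_subgroup nat_pow_closed rcos_self)
qed

section \<open>Sylow theory\<close>

text \<open>Orbit sizes divide p^k, so an orbit whose size is prime to p is a single fixed point;
  all remaining orbits vanish modulo p.\<close>

lemma (in group_action) p_group_fixed_points:
  assumes p: "prime (p::nat)" and ord: "order G = p ^ k" and fin: "finite E"
  shows "card E mod p = card {x \<in> E. \<forall>g\<in>carrier G. \<phi> g x = x} mod p"
proof -
  let ?F = "{x \<in> E. \<forall>g\<in>carrier G. \<phi> g x = x}"
  let ?C = "{orb \<in> orbits G E \<phi>. p dvd card orb}"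
  have E: "\<Union> (orbits G E \<phi>) = E" by (rule orbits_coverture)
  have dj: "\<forall>c1\<in>orbits G E \<phi>. \<forall>c2\<in>orbits G E \<phi>. c1 \<noteq> c2 \<longrightarrow> c1 \<inter> c2 = {}"
    using disjoint_union by blast
  have fixd: "x \<in> ?F \<longleftrightarrow> x \<notin> \<Union>?C" if x: "x \<in> E" for x
  proof
    assume "x \<in> ?F"
    hence "orbit G \<phi> x \<subseteq> {x}" by (auto simp: orbit_def)
    hence orb: "orbit G \<phi> x = {x}" using orbit_refl[OF x] by blast
    show "x \<notin> \<Union>?C"
    proof
      assume "x \<in> \<Union>?C"
      then obtain c where c: "c \<in> orbits G E \<phi>" "p dvd card c" "x \<in> c" by blast
      have "{x} \<in> orbits G E \<phi>" using x orb unfolding orbits_def by blast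
      hence "c = {x}" using disjoint_union[OF c(1)] c(3) by blast
      thus False using c(2) p by simp
    qed
  next
    assume nx: "x \<notin> \<Union>?C"
    have xo: "x \<in> orbit G \<phi> x" using x by (rule orbit_refl)
    have "orbit G \<phi> x \<in> orbits G E \<phi>" using x unfolding orbits_def by blast
    hence "\<not> p dvd card (orbit G \<phi> x)" using nx xo by blast
    moreover have "card (orbit G \<phi> x) dvd p ^ k"
      using orbit_stabilizer_theorem[OF x] ord by (metis dvd_triv_left)
    ultimately have "card (orbit G \<phi> x) = 1"
      using p by (metis divides_primepow_nat dvd_power gr0I power_0)
    then obtain y where "orbit G \<phi> x = {y}" by (auto simp: card_1_singleton_iff)
    hence "orbit G \<phi> x = {x}" using xo by auto
    thus "x \<in> ?F" using x by (auto simp: orbit_def)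
  qed
  have sub: "\<Union>?C \<subseteq> E" using E by blast
  have F: "?F = E - \<Union>?C" using fixd by blast
  have "p dvd card (\<Union>?C)"
    by (rule dvd_partition) (use dj finite_subset[OF sub fin] in auto)
  moreover have "card E = card ?F + card (\<Union>?C)"
    unfolding F using card_Diff_subset[OF finite_subset[OF sub fin] sub] card_mono[OF fin sub] by simp
  ultimately show ?thesis by (auto elim!: dvdE)
qed

text \<open>Bijectivity is free, since the inverse element undoes the map. The restriction to
  \<open>E\<close> is there because \<open>Bij E\<close> consists of extensional functions.\<close>

lemma (in group) group_actionI:
  assumes closed: "\<And>g x. g \<in> carrier G \<Longrightarrow> x \<in> E \<Longrightarrow> f g x \<in> E"
    and one: "\<And>x. x \<in> E \<Longrightarrow> f \<one> x = x"
    and mult: "\<And>g h x. g \<in> carrier G \<Longrightarrow> h \<in> carrier G \<Longrightarrow> x \<in> E \<Longrightarrow> f (g \<otimes> h) x = f g (f h x)"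
  shows "group_action G E (\<lambda>g. restrict (f g) E)"
proof -
  have bij: "restrict (f g) E \<in> Bij E" if g: "g \<in> carrier G" for g
  proof -
    have "bij_betw (f g) E E"
      by (rule bij_betw_byWitness[where f' = "f (inv g)"])
        (use g closed one mult[of "inv g" g] mult[of g "inv g"] in auto)
    thus ?thesis by (simp add: Bij_def bij_betw_restrict_eq)
  qed
  have "(\<lambda>g. restrict (f g) E) \<in> hom G (BijGroup E)"
    using bij by (auto simp: hom_def BijGroup_def mult closed compose_def fun_eq_iff restrict_def)
  thus ?thesis
    by (simp add: group_action_def group_hom_def group_hom_axioms_def group_BijGroup is_group)
qed

locale finite_group = group G for G (structure) +
  assumes finite_carrier [simp]: "finite (carrier G)"

lemma (in finite_group) finite_subgroup: "subgroup H G \<Longrightarrow> finite H"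
  using finite_carrier finite_subset subgroup.subset by blast

lemma (in finite_group) finite_subgroups: "finite {H. subgroup H G}"
  by (rule finite_subset[of _ "Pow (carrier G)"]) (auto dest: subgroup.subset)

lemma (in finite_group) card_subgroup_dvd: "subgroup H G \<Longrightarrow> card H dvd order G"
  by (metis dvd_triv_right lagrange)

lemma (in finite_group) finite_group_subgroup: "subgroup H G \<Longrightarrow> finite_group (G\<lparr>carrier := H\<rparr>)"
  by (simp add: finite_group_def finite_group_axioms_def finite_subgroup subgroup_imp_group)

lemma (in finite_group) pow_card_subgroup:
  assumes "subgroup H G" "x \<in> H"
  shows "x [^] card H = \<one>"
  using finite_group.axioms(1)[OF finite_group_subgroup[OF assms(1)], THEN group.pow_order_eq_1, of x] assms
  by (simp add: order_def flip: nat_pow_consistent)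

text \<open>For x in \<open>D\<close>, both x^|D| = 1 and x^[G:H] lie in \<open>H\<close>, and the
  two exponents are coprime.\<close>

lemma (in finite_group) coprime_index_subset:
  assumes "H \<lhd> G" "subgroup D G" "coprime (card D) (order G div card H)"
  shows "D \<subseteq> H"
proof
  fix x assume x: "x \<in> D"
  interpret H: normal H G by fact
  have xG: "x \<in> carrier G" using assms(2) x by (rule subgroup.mem_carrier)
  show "x \<in> H"
    using pow_coprime_mem[OF H.is_subgroup xG _ H.pow_index_mem[OF finite_carrier xG] assms(3)]
      pow_card_subgroup[OF assms(2) x] H.one_closed by simp
qed

lemma (in finite_group) card_Int_coprime:
  assumes "subgroup H G" "subgroup K G" "coprime (card H) (card K)"
  shows "H \<inter> K = {\<one>}"
proof
  show "H \<inter> K \<subseteq> {\<one>}"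
  proof
    fix x assume x: "x \<in> H \<inter> K"
    have "x \<in> {\<one>}"
      by (rule pow_coprime_mem[OF triv_subgroup _ _ _ assms(3)])
        (use x assms pow_card_subgroup subgroup.mem_carrier in auto)
    thus "x \<in> {\<one>}" .
  qed
qed (use assms subgroup.one_closed in auto)

text \<open>Allows an action by a plain function of a subgroup, so that conjugation of elements, of
  Sylow subgroups and of subgroups of order 2 can be inserted directly.\<close>

lemma (in finite_group) p_subgroup_fixed_points:
  assumes "prime (p::nat)" "subgroup P G" "card P = p ^ k" "finite E"
    and "\<And>g x. g \<in> P \<Longrightarrow> x \<in> E \<Longrightarrow> f g x \<in> E" "\<And>x. x \<in> E \<Longrightarrow> f \<one> x = x"
    and "\<And>g h x. g \<in> P \<Longrightarrow> h \<in> P \<Longrightarrow> x \<in> E \<Longrightarrow> f (g \<otimes> h) x = f g (f h x)"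
  shows "card E mod p = card {x \<in> E. \<forall>g\<in>P. f g x = x} mod p"
proof -
  interpret P: finite_group "G\<lparr>carrier := P\<rparr>" using assms(2) by (rule finite_group_subgroup)
  have "group_action (G\<lparr>carrier := P\<rparr>) E (\<lambda>g. restrict (f g) E)"
    by (rule P.group_actionI) (use assms in auto)
  from group_action.p_group_fixed_points[OF this assms(1) _ assms(4), of k] assms(3)
  have "card E mod p = card {x \<in> E. \<forall>g\<in>P. restrict (f g) E x = x} mod p"
    by (simp add: order_def)
  also have "{x \<in> E. \<forall>g\<in>P. restrict (f g) E x = x} = {x \<in> E. \<forall>g\<in>P. f g x = x}" by auto
  finally show ?thesis .
qed

section \<open>Conjugates and normalizers\<close>

context group
begin

definition conj_set :: "'a \<Rightarrow> 'a set \<Rightarrow> 'a set" where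
  "conj_set x H = (\<lambda>h. x \<otimes> h \<otimes> inv x) ` H"

definition normalizer_of :: "'a set \<Rightarrow> 'a set" where
  "normalizer_of H = {x \<in> carrier G. conj_set x H = H}"

lemma conj_set_subset: "x \<in> carrier G \<Longrightarrow> H \<subseteq> carrier G \<Longrightarrow> conj_set x H \<subseteq> carrier G"
  by (auto simp: conj_set_def)

lemma conj_set_one: "H \<subseteq> carrier G \<Longrightarrow> conj_set \<one> H = H"
  by (force simp: conj_set_def)

lemma conj_set_mult:
  assumes "x \<in> carrier G" "y \<in> carrier G" "H \<subseteq> carrier G"
  shows "conj_set (x \<otimes> y) H = conj_set x (conj_set y H)"
  unfolding conj_set_def image_image
  by (rule image_cong[OF refl]) (use assms in \<open>auto simp: m_assoc inv_mult_group subset_iff\<close>)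

lemma card_conj_set: "x \<in> carrier G \<Longrightarrow> H \<subseteq> carrier G \<Longrightarrow> card (conj_set x H) = card H"
  unfolding conj_set_def by (rule card_image) (auto simp: inj_on_def subset_iff)

lemma subgroup_conj_set:
  assumes "x \<in> carrier G" "subgroup H G"
  shows "subgroup (conj_set x H) G"
proof -
  have "inv (inv x) <# H #> inv x = conj_set x H"
    using assms(1) by (auto simp: conj_set_def l_coset_def r_coset_def)
  thus ?thesis using subgroup_conjugation_is_surj1[of "inv x" H] assms by simp
qed

lemma conj_set_inv_self:
  assumes "x \<in> carrier G" "H \<subseteq> carrier G"
  shows "conj_set (inv x) (conj_set x H) = H"
  using conj_set_mult[of "inv x" x H] assms by (simp add: conj_set_one)

lemma subgroup_normalizer_of:
  assumes "H \<subseteq> carrier G"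
  shows "subgroup (normalizer_of H) G"
proof (rule subgroupI)
  show "normalizer_of H \<noteq> {}" using assms by (auto simp: normalizer_of_def conj_set_one intro!: exI[of _ \<one>])
  show "inv x \<in> normalizer_of H" if "x \<in> normalizer_of H" for x
    using that assms conj_set_inv_self[of x H] by (auto simp: normalizer_of_def)
qed (use assms in \<open>auto simp: normalizer_of_def conj_set_mult\<close>)

lemma subset_normalizer_of:
  assumes "subgroup H G"
  shows "H \<subseteq> normalizer_of H"
proof
  fix x assume x: "x \<in> H"
  have xG: "x \<in> carrier G" "inv x \<in> H" using assms x by (auto simp: subgroup.mem_carrier subgroup.m_inv_closed)
  have "conj_set y H \<subseteq> H" if "y \<in> H" for y
    using that assms by (auto simp: conj_set_def subgroup.m_closed subgroup.m_inv_closed)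
  hence "conj_set x H \<subseteq> H" "conj_set (inv x) H \<subseteq> H" using x xG by auto
  moreover have "H = conj_set x (conj_set (inv x) H)"
    using conj_set_inv_self[of "inv x" H] xG subgroup.subset[OF assms] by simp
  ultimately have "conj_set x H = H" unfolding conj_set_def by blast
  thus "x \<in> normalizer_of H" using xG by (simp add: normalizer_of_def)
qed

text \<open>Identifies the normalizer as the largest subgroup in which \<open>H\<close> is normal.
  Inclusion of every conjugate in \<open>H\<close> gives equality when it is applied to the inverse
  element as well.\<close>

lemma normal_in_subgroup_iff:
  assumes "subgroup H G" "subgroup K G" "H \<subseteq> K"
  shows "H \<lhd> G\<lparr>carrier := K\<rparr> \<longleftrightarrow> K \<subseteq> normalizer_of H"
proof -
  interpret K: group "G\<lparr>carrier := K\<rparr>" using assms(2) by (rule subgroup_imp_group)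
  have inv: "inv\<^bsub>G\<lparr>carrier := K\<rparr>\<^esub> x = inv x" if "x \<in> K" for x
    using m_inv_consistent[OF assms(2) that] .
  have KG: "x \<in> carrier G" if "x \<in> K" for x using assms(2) that by (rule subgroup.mem_carrier)
  have "H \<lhd> G\<lparr>carrier := K\<rparr> \<longleftrightarrow> (\<forall>x\<in>K. conj_set x H \<subseteq> H)"
    using assms subgroup_incl[OF assms] by (auto simp: K.normal_inv_iff inv conj_set_def)
  also have "\<dots> \<longleftrightarrow> K \<subseteq> normalizer_of H"
  proof
    assume *: "\<forall>x\<in>K. conj_set x H \<subseteq> H"
    show "K \<subseteq> normalizer_of H"
    proof
      fix x assume x: "x \<in> K"
      have ix: "inv x \<in> K" using assms(2) x by (rule subgroup.m_inv_closed)
      have "H = conj_set x (conj_set (inv x) H)"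
        using conj_set_inv_self[of "inv x" H] KG[OF x] subgroup.subset[OF assms(1)] by simp
      hence "H \<subseteq> conj_set x H" using * ix unfolding conj_set_def by blast
      thus "x \<in> normalizer_of H" using * x KG by (auto simp: normalizer_of_def)
    qed
  qed (auto simp: normalizer_of_def)
  finally show ?thesis .
qed

lemma normal_iff_normalizer_of:
  assumes "subgroup H G"
  shows "H \<lhd> G \<longleftrightarrow> normalizer_of H = carrier G"
  using normal_in_subgroup_iff[OF assms subgroup_self subgroup.subset[OF assms]]
  by (auto simp: normalizer_of_def)

lemma card_conj_set_orbit:
  assumes "H \<subseteq> carrier G"
  shows "card {conj_set x H |x. x \<in> carrier G} * card (normalizer_of H) = order G"
proof -
  have act: "group_action G {K. K \<subseteq> carrier G} (\<lambda>g. restrict (conj_set g) {K. K \<subseteq> carrier G})"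
    by (rule group_actionI) (auto simp: conj_set_one conj_set_mult dest: conj_set_subset)
  have "orbit G (\<lambda>g. restrict (conj_set g) {K. K \<subseteq> carrier G}) H = {conj_set x H |x. x \<in> carrier G}"
    "stabilizer G (\<lambda>g. restrict (conj_set g) {K. K \<subseteq> carrier G}) H = normalizer_of H"
    using assms by (auto simp: orbit_def stabilizer_def normalizer_of_def)
  thus ?thesis using group_action.orbit_stabilizer_theorem[OF act, of H] assms by simp
qed

end

lemma (in finite_group) order_pos: "0 < order G"
  by (simp add: order_gt_0_iff_finite)

section \<open>Sylow's theorems and the primes missing from a Sylow normalizer\<close>

context finite_group
begin

text \<open>For a prime that does not divide the order, the only member is the trivial
  subgroup.\<close>

definition Syl :: "nat \<Rightarrow> 'a set set" where
  "Syl p = {P. subgroup P G \<and> card P = p ^ multiplicity p (order G)}"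

lemma SylD:
  assumes "P \<in> Syl p"
  shows "subgroup P G" "card P = p ^ multiplicity p (order G)" "P \<subseteq> carrier G"
  using assms by (auto simp: Syl_def subgroup.subset)

lemma finite_Syl: "finite (Syl p)"
  by (rule finite_subset[OF _ finite_subgroups]) (auto simp: Syl_def)

lemma Syl_nonempty:
  assumes "prime p"
  shows "Syl p \<noteq> {}"
proof -
  obtain m where "order G = p ^ multiplicity p (order G) * m"
    using multiplicity_dvd by blast
  from sylow_thm[OF assms is_group this finite_carrier] show ?thesis by (auto simp: Syl_def)
qed

lemma coprime_Syl_index:
  assumes "prime p"
  shows "coprime (p ^ k) (order G div p ^ multiplicity p (order G))"
proof -
  have "\<not> p dvd order G div p ^ multiplicity p (order G)"
  proof -
    have nz: "order G \<noteq> 0" "\<not> is_unit p" using order_pos assms not_prime_unit by auto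
    obtain y where y: "order G = p ^ multiplicity p (order G) * y" "\<not> p dvd y"
      using multiplicity_decompose'[OF nz] .
    have "order G div p ^ multiplicity p (order G) = y"
      by (subst (1) y(1)) (use assms in \<open>simp add: prime_gt_0_nat\<close>)
    thus ?thesis using y(2) by simp
  qed
  thus ?thesis using assms by (simp add: prime_imp_coprime)
qed

text \<open>\<open>P\<close> is normal in its normalizer with index prime to p, so it absorbs every
  p-subgroup of the normalizer.\<close>

lemma Syl_normalized_subset:
  assumes p: "prime p" and P: "P \<in> Syl p" and D: "subgroup D G" "D \<subseteq> normalizer_of P" "card D = p ^ k"
  shows "D \<subseteq> P"
proof -
  note P' = SylD[OF P]
  have N: "subgroup (normalizer_of P) G" by (rule subgroup_normalizer_of[OF P'(3)])
  interpret N: finite_group "G\<lparr>carrier := normalizer_of P\<rparr>" using N by (rule finite_group_subgroup)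
  have PN: "P \<subseteq> normalizer_of P" by (rule subset_normalizer_of[OF P'(1)])
  have nrm: "P \<lhd> G\<lparr>carrier := normalizer_of P\<rparr>" using normal_in_subgroup_iff[OF P'(1) N PN] by simp
  have "card (normalizer_of P) div card P dvd order G div card P"
    using card_subgroup_dvd[OF N] N.card_subgroup_dvd[OF subgroup_incl[OF P'(1) N PN]]
    by (auto simp: order_def intro!: div_dvd_div[THEN iffD2])
  hence "coprime (card D) (card (normalizer_of P) div card P)"
    using coprime_Syl_index[OF p, of k] unfolding D(3) P'(2) by (rule coprime_divisors[OF dvd_refl])
  thus ?thesis
    using N.coprime_index_subset[OF nrm subgroup_incl[OF D(1) N D(2)]] by (simp add: order_def)
qed

lemma Syl_normalized_eq:
  assumes "prime p" "P \<in> Syl p" "Q \<in> Syl p" "Q \<subseteq> normalizer_of P"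
  shows "Q = P"
proof (rule card_subset_eq)
  show "Q \<subseteq> P" using Syl_normalized_subset[OF assms(1,2)] assms(3,4) SylD by blast
  show "finite P" using SylD(1)[OF assms(2)] by (rule finite_subgroup)
  show "card Q = card P" using SylD(2)[OF assms(2)] SylD(2)[OF assms(3)] by simp
qed

lemma conj_set_Syl: "x \<in> carrier G \<Longrightarrow> P \<in> Syl p \<Longrightarrow> conj_set x P \<in> Syl p"
  by (auto simp: Syl_def subgroup_conj_set card_conj_set subgroup.subset)

text \<open>Let \<open>P\<close> act on the conjugates of \<open>Q\<close>. A conjugate fixed by
  \<open>P\<close> has \<open>P\<close> in its normalizer and therefore equals \<open>P\<close>, so
  there is at most one fixed point.\<close>

lemma card_Syl_orbit_mod:
  assumes p: "prime p" and P: "P \<in> Syl p" and Q: "Q \<in> Syl p"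
  shows "card {conj_set x Q |x. x \<in> carrier G} mod p = (if P \<in> {conj_set x Q |x. x \<in> carrier G} then 1 else 0)"
proof -
  let ?O = "{conj_set x Q |x. x \<in> carrier G}"
  note P' = SylD[OF P]
  have O: "?O \<subseteq> Syl p" using Q conj_set_Syl by auto
  have PG: "g \<in> carrier G" if "g \<in> P" for g using that P' by auto
  have "card ?O mod p = card {K \<in> ?O. \<forall>g\<in>P. conj_set g K = K} mod p"
  proof (rule p_subgroup_fixed_points[OF p P'(1,2)])
    show "finite ?O" using O finite_Syl finite_subset by blast
    show "conj_set g K \<in> ?O" if gK: "g \<in> P" "K \<in> ?O" for g K
    proof -
      obtain x where x: "x \<in> carrier G" "K = conj_set x Q" using gK(2) by blast
      have "conj_set g K = conj_set (g \<otimes> x) Q"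
        using x PG[OF gK(1)] SylD(3)[OF Q] by (simp add: conj_set_mult)
      thus ?thesis using x(1) PG[OF gK(1)] by blast
    qed
    show "conj_set \<one> K = K" if "K \<in> ?O" for K
      using that O SylD(3) by (auto intro!: conj_set_one)
    show "conj_set (g \<otimes> h) K = conj_set g (conj_set h K)" if "g \<in> P" "h \<in> P" "K \<in> ?O" for g h K
      using that O SylD(3) PG by (intro conj_set_mult) auto
  qed
  also have "{K \<in> ?O. \<forall>g\<in>P. conj_set g K = K} = ?O \<inter> {P}"
  proof (rule Set.set_eqI)
    fix K
    show "K \<in> {K \<in> ?O. \<forall>g\<in>P. conj_set g K = K} \<longleftrightarrow> K \<in> ?O \<inter> {P}"
    proof
      assume K: "K \<in> {K \<in> ?O. \<forall>g\<in>P. conj_set g K = K}"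
      hence "K \<in> Syl p" "P \<subseteq> normalizer_of K" using O PG by (auto simp: normalizer_of_def)
      hence "P = K" using Syl_normalized_eq[OF p _ P] by blast
      thus "K \<in> ?O \<inter> {P}" using K by blast
    next
      assume "K \<in> ?O \<inter> {P}"
      thus "K \<in> {K \<in> ?O. \<forall>g\<in>P. conj_set g K = K}" using subset_normalizer_of[OF P'(1)] by (auto simp: normalizer_of_def)
    qed
  qed
  finally show ?thesis using prime_gt_1_nat[OF p] by auto
qed

text \<open>The conjugacy class of \<open>P\<close> has size 1 modulo p, as seen by letting
  \<open>P\<close> act. Letting another Sylow subgroup \<open>Q\<close> act gives 0 unless
  \<open>Q\<close> belongs to the class.\<close>

lemma Syl_conjugate:
  assumes p: "prime p" and P: "P \<in> Syl p"
  shows "{conj_set x P |x. x \<in> carrier G} = Syl p"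
proof
  show "{conj_set x P |x. x \<in> carrier G} \<subseteq> Syl p" using P conj_set_Syl by auto
  have self: "P \<in> {conj_set x P |x. x \<in> carrier G}"
    by (rule CollectI, rule exI[of _ "\<one>"]) (simp add: conj_set_one SylD(3)[OF P])
  show "Syl p \<subseteq> {conj_set x P |x. x \<in> carrier G}"
  proof
    fix Q assume Q: "Q \<in> Syl p"
    have "card {conj_set x P |x. x \<in> carrier G} mod p = 1"
      using card_Syl_orbit_mod[OF p P P] self by simp
    with card_Syl_orbit_mod[OF p Q P]
    have "(if Q \<in> {conj_set x P |x. x \<in> carrier G} then 1 else 0) = (1 :: nat)" by (rule subst)
    thus "Q \<in> {conj_set x P |x. x \<in> carrier G}" by presburger
  qed
qed

lemma card_Syl_mod:
  assumes p: "prime p"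
  shows "card (Syl p) mod p = 1"
proof -
  obtain P where P: "P \<in> Syl p" using Syl_nonempty[OF p] by blast
  show ?thesis
    using card_Syl_orbit_mod[OF p P P] P unfolding Syl_conjugate[OF p P] by simp
qed

lemma card_Syl_pos: "prime p \<Longrightarrow> 0 < card (Syl p)"
  by (simp add: card_gt_0_iff Syl_nonempty finite_Syl)

lemma card_Syl_normalizer_of:
  assumes "prime p" "P \<in> Syl p"
  shows "card (Syl p) * card (normalizer_of P) = order G"
  using card_conj_set_orbit[OF SylD(3)[OF assms(2)]] unfolding Syl_conjugate[OF assms] .

lemma card_Syl_eq_1_iff:
  assumes p: "prime p" and P: "P \<in> Syl p"
  shows "card (Syl p) = 1 \<longleftrightarrow> P \<lhd> G"
proof -
  have "card (Syl p) = 1 \<longleftrightarrow> card (normalizer_of P) = order G"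
    using order_pos unfolding card_Syl_normalizer_of[OF assms, symmetric] by auto
  also have "\<dots> \<longleftrightarrow> normalizer_of P = carrier G"
    using card_subset_eq[OF finite_carrier subgroup.subset[OF subgroup_normalizer_of[OF SylD(3)[OF P]]]]
    by (auto simp: order_def)
  finally show ?thesis using normal_iff_normalizer_of[OF SylD(1)[OF P]] by simp
qed

text \<open>Every Sylow p-subgroup P satisfies |N(P)| = |G| / i, so this is the set M of the
  overview, written without choosing P.\<close>

definition missing :: "nat \<Rightarrow> nat set" where
  "missing p = {q \<in> prime_factors (order G). \<not> q dvd order G div card (Syl p)}"

lemma card_normalizer_of_Syl:
  assumes "prime p" "P \<in> Syl p"
  shows "card (normalizer_of P) = order G div card (Syl p)"
  using card_Syl_pos[OF assms(1)] by (simp flip: card_Syl_normalizer_of[OF assms])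

text \<open>In |G| = i |N(P)| the second factor is prime to q, so the whole q-part of |G| sits in
  i.\<close>

lemma missing_power_dvd:
  assumes p: "prime p" and q: "q \<in> missing p"
  shows "q ^ multiplicity q (order G) dvd card (Syl p)"
proof -
  obtain P where P: "P \<in> Syl p" using Syl_nonempty[OF p] by blast
  have q': "prime q" "\<not> q dvd card (normalizer_of P)"
    using q card_normalizer_of_Syl[OF p P] by (auto simp: missing_def in_prime_factors_iff)
  have "q ^ multiplicity q (order G) dvd card (Syl p) * card (normalizer_of P)"
    using card_Syl_normalizer_of[OF p P] multiplicity_dvd by simp
  thus ?thesis using q' by (simp add: coprime_dvd_mult_left_iff prime_imp_coprime)
qed

lemma self_notin_missing:
  assumes p: "prime p" "p dvd order G"
  shows "p \<notin> missing p"
proof -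
  obtain P where P: "P \<in> Syl p" using Syl_nonempty[OF p(1)] by blast
  have "multiplicity p (order G) > 0"
    using p order_pos by (simp add: prime_multiplicity_gt_zero_iff)
  hence "p dvd card P" using SylD(2)[OF P] by simp
  also have "card P dvd card (normalizer_of P)"
    using finite_group.card_subgroup_dvd[OF finite_group_subgroup[OF subgroup_normalizer_of[OF SylD(3)[OF P]]]
        subgroup_incl[OF SylD(1)[OF P] subgroup_normalizer_of[OF SylD(3)[OF P]] subset_normalizer_of[OF SylD(1)[OF P]]]]
    by (simp add: order_def)
  finally show ?thesis using card_normalizer_of_Syl[OF p(1) P] by (simp add: missing_def)
qed

text \<open>A Sylow p-subgroup P acts by conjugation on the normal Sylow q-subgroup Q. A fixed
  element commutes with P and so lies in N(P), whose order is prime to q; hence only the identity is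
  fixed and |Q| is 1 modulo p.\<close>

lemma missing_normal_mod:
  assumes p: "prime p" and q: "q \<in> missing p" and nq: "card (Syl q) = 1"
  shows "q ^ multiplicity q (order G) mod p = 1"
proof -
  have q': "prime q" using q by (auto simp: missing_def in_prime_factors_iff)
  obtain P where P: "P \<in> Syl p" using Syl_nonempty[OF p] by blast
  obtain Q where Q: "Q \<in> Syl q" using Syl_nonempty[OF q'] by blast
  note P' = SylD[OF P] and Q' = SylD[OF Q]
  have PG: "g \<in> carrier G" if "g \<in> P" for g using that P' by auto
  have QG: "g \<in> carrier G" if "g \<in> Q" for g using that Q' by auto
  have Qn: "Q \<lhd> G" using card_Syl_eq_1_iff[OF q' Q] nq by simp
  have "card Q mod p = card {x \<in> Q. \<forall>g\<in>P. g \<otimes> x \<otimes> inv g = x} mod p"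
  proof (rule p_subgroup_fixed_points[OF p P'(1,2)])
    show "finite Q" using Q'(1) by (rule finite_subgroup)
    show "g \<otimes> x \<otimes> inv g \<in> Q" if "g \<in> P" "x \<in> Q" for g x
      using normal_invE(2)[OF Qn PG[OF that(1)] that(2)] .
    show "\<one> \<otimes> x \<otimes> inv \<one> = x" if "x \<in> Q" for x using QG[OF that] by simp
    show "g \<otimes> h \<otimes> x \<otimes> inv (g \<otimes> h) = g \<otimes> (h \<otimes> x \<otimes> inv h) \<otimes> inv g"
      if "g \<in> P" "h \<in> P" "x \<in> Q" for g h x
      using PG[OF that(1)] PG[OF that(2)] QG[OF that(3)] by (simp add: m_assoc inv_mult_group)
  qed
  also have "{x \<in> Q. \<forall>g\<in>P. g \<otimes> x \<otimes> inv g = x} = {\<one>}"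
  proof
    have "coprime (card Q) (card (normalizer_of P))"
      using q q' card_normalizer_of_Syl[OF p P] Q'(2) by (auto simp: missing_def prime_imp_coprime)
    hence int: "Q \<inter> normalizer_of P = {\<one>}"
      by (rule card_Int_coprime[OF Q'(1) subgroup_normalizer_of[OF P'(3)]])
    show "{x \<in> Q. \<forall>g\<in>P. g \<otimes> x \<otimes> inv g = x} \<subseteq> {\<one>}"
    proof
      fix x assume x: "x \<in> {x \<in> Q. \<forall>g\<in>P. g \<otimes> x \<otimes> inv g = x}"
      have "x \<otimes> g \<otimes> inv x = g" if g: "g \<in> P" for g
      proof -
        have "g \<otimes> x \<otimes> inv g = x" using x g by blast
        hence "g \<otimes> x = x \<otimes> g" using x g PG QG by (metis (no_types, lifting) inv_solve_right' m_closed mem_Collect_eq)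
        thus ?thesis using x g PG QG by (metis (no_types, lifting) inv_solve_right m_closed mem_Collect_eq)
      qed
      hence "conj_set x P = P" by (simp add: conj_set_def)
      hence "x \<in> Q \<inter> normalizer_of P" using x QG by (auto simp: normalizer_of_def)
      thus "x \<in> {\<one>}" using int by simp
    qed
    show "{\<one>} \<subseteq> {x \<in> Q. \<forall>g\<in>P. g \<otimes> x \<otimes> inv g = x}"
      using PG subgroup.one_closed[OF Q'(1)] by auto
  qed
  finally show ?thesis using Q'(2) prime_gt_1_nat[OF p] by simp
qed

end

section \<open>Subgroups normalizing a Sylow subgroup\<close>

text \<open>An elementary case of Schur-Zassenhaus. If x lifts a generator, then y = x^|H| has order
  dividing |G/H|; its image still has order |G/H| because |H| is coprime to that order, so y
  generates a complement.\<close>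

lemma (in normal) cyclic_Mod_complement:
  assumes fin: "finite (carrier G)" and cyc: "cyclic_group (G Mod H)"
    and cop: "coprime (card H) (order (G Mod H))"
  obtains K where "subgroup K G" "card K = order (G Mod H)"
proof -
  interpret Q: group "G Mod H" by (rule factorgroup_is_group)
  obtain X where X: "X \<in> carrier (G Mod H)" "subgroup_generated (G Mod H) {X} = G Mod H"
    using cyc by (auto simp: cyclic_group_def)
  have ordX: "Q.ord X = order (G Mod H)"
    using Q.cyclic_order_is_ord[OF X(1)] unfolding X(2) .
  obtain x where x: "x \<in> carrier G" "X = H #> x"
    using X(1) by (auto simp: carrier_FactGroup)
  define y where "y = x [^] card H"
  have y: "y \<in> carrier G" using x by (simp add: y_def)
  have "ord y dvd order (G Mod H)"
  proof -
    have "y [^] order (G Mod H) = x [^] order G"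
      using x by (simp add: y_def nat_pow_pow mult.commute flip: order_Mod)
    also have "\<dots> = \<one>" using x by (simp add: pow_order_eq_1)
    finally show ?thesis using y by (simp add: pow_eq_id)
  qed
  moreover have "order (G Mod H) dvd ord y"
  proof -
    have "x [^] (card H * ord y) = y [^] ord y"
      unfolding y_def by (rule nat_pow_pow[OF x(1), symmetric])
    hence "x [^] (card H * ord y) = \<one>" using y by simp
    hence "X [^]\<^bsub>G Mod H\<^esub> (card H * ord y) = \<one>\<^bsub>G Mod H\<^esub>"
      using x FactGroup_pow[OF x(1), of "card H * ord y"] subset by simp
    hence "order (G Mod H) dvd card H * ord y"
      using Q.pow_eq_id[OF X(1)] ordX by simp
    thus ?thesis using cop by (simp add: coprime_dvd_mult_right_iff coprime_commute)
  qed
  ultimately have "ord y = order (G Mod H)" by (rule dvd_antisym)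
  thus thesis
    using that[of "generate G {y}"] y by (simp add: generate_pow_card generate_is_subgroup)
qed

section \<open>Subgroups between a Sylow subgroup and its normalizer\<close>

context finite_group
begin

definition syl_normal :: "nat \<Rightarrow> 'a set set" where
  "syl_normal p = {H. subgroup H G \<and> (\<exists>P\<in>Syl p. P \<subseteq> H \<and> H \<subseteq> normalizer_of P)}"

text \<open>Excluding the missing primes along with p keeps this family disjoint from
  \<open>syl_normal q\<close> for every missing q too, so that all these counts can be
  added.\<close>

definition syl_free :: "nat \<Rightarrow> 'a set set" where
  "syl_free p = {H. subgroup H G \<and> (\<forall>q\<in>insert p (missing p). \<not> q dvd card H)}"

abbreviation Syl_quot :: "'a set \<Rightarrow> 'a set monoid" where
  "Syl_quot P \<equiv> G\<lparr>carrier := normalizer_of P\<rparr> Mod P"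

lemma prime_dvd_order: "p \<in> prime_factors (order G) \<longleftrightarrow> prime p \<and> p dvd order G"
  using order_pos by (auto simp: in_prime_factors_iff)

lemma dvd_card_Syl:
  assumes "p \<in> prime_factors (order G)" "P \<in> Syl p"
  shows "p dvd card P"
  using assms SylD(2)[OF assms(2)] order_pos
  by (auto simp: prime_dvd_order prime_multiplicity_gt_zero_iff)

lemma normal_normalizer_of_Syl:
  assumes "P \<in> Syl p"
  shows "P \<lhd> G\<lparr>carrier := normalizer_of P\<rparr>"
  using normal_in_subgroup_iff[OF SylD(1)[OF assms] subgroup_normalizer_of[OF SylD(3)[OF assms]]
      subset_normalizer_of[OF SylD(1)[OF assms]]] by simp

lemma order_Syl_quot:
  assumes "P \<in> Syl p"
  shows "order (Syl_quot P) * card P = card (normalizer_of P)"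
  using normal.order_Mod[OF normal_normalizer_of_Syl[OF assms]] by (simp add: order_def)

lemma card_subgroups_between_Syl:
  assumes P: "P \<in> Syl p"
  shows "card {H. subgroup H G \<and> P \<subseteq> H \<and> H \<subseteq> normalizer_of P} = num_subgroups (Syl_quot P)"
proof -
  have N: "subgroup (normalizer_of P) G" by (rule subgroup_normalizer_of[OF SylD(3)[OF P]])
  have "{H. subgroup H (G\<lparr>carrier := normalizer_of P\<rparr>) \<and> P \<subseteq> H} = {H. subgroup H G \<and> P \<subseteq> H \<and> H \<subseteq> normalizer_of P}"
    using subgroups_of_subgroup[OF N] by blast
  thus ?thesis using normal.num_subgroups_Mod[OF normal_normalizer_of_Syl[OF P]] by simp
qed

text \<open>The intervals from P to N(P) are disjoint for different P: a subgroup of N(P) that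
  contains P has no other Sylow p-subgroup. The correspondence theorem counts each interval.\<close>

lemma card_syl_normal:
  assumes p: "prime p"
  shows "card (syl_normal p) = (\<Sum>P\<in>Syl p. num_subgroups (Syl_quot P))"
proof -
  let ?T = "\<lambda>P. {H. subgroup H G \<and> P \<subseteq> H \<and> H \<subseteq> normalizer_of P}"
  have "syl_normal p = (\<Union>P\<in>Syl p. ?T P)" by (auto simp: syl_normal_def)
  also have "card \<dots> = (\<Sum>P\<in>Syl p. card (?T P))"
  proof (rule card_UN_disjoint[OF finite_Syl])
    show "\<forall>P\<in>Syl p. finite (?T P)" using finite_subgroups by simp
    show "\<forall>P\<in>Syl p. \<forall>Q\<in>Syl p. P \<noteq> Q \<longrightarrow> ?T P \<inter> ?T Q = {}"
      using Syl_normalized_eq[OF p] by blast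
  qed
  also have "\<dots> = (\<Sum>P\<in>Syl p. num_subgroups (Syl_quot P))"
    by (rule sum.cong) (auto simp: card_subgroups_between_Syl)
  finally show ?thesis .
qed

text \<open>The primes dividing |G| are those of N(P)/P, the prime p itself and the missing ones,
  without overlap. This is where the exponent |M| + 1 in all later bounds comes from.\<close>

lemma num_primes_Syl_quot:
  assumes p: "p \<in> prime_factors (order G)" and P: "P \<in> Syl p"
  shows "num_primes G = num_primes (Syl_quot P) + (card (missing p) + 1)"
    and "q \<in> insert p (missing p) \<Longrightarrow> \<not> q dvd order (Syl_quot P)"
proof -
  have p': "prime p" "p dvd order G" using p by (auto simp: prime_dvd_order)
  have eq: "card (Syl p) * (order (Syl_quot P) * card P) = order G"
    using card_Syl_normalizer_of[OF p'(1) P] order_Syl_quot[OF P] by simp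
  have pos: "order (Syl_quot P) > 0" "card P > 0" "card (normalizer_of P) > 0"
    using eq order_pos order_Syl_quot[OF P] by (auto intro!: gr0I)
  have np: "\<not> p dvd order (Syl_quot P)"
  proof
    assume "p dvd order (Syl_quot P)"
    hence "p * card P dvd card (Syl p) * (order (Syl_quot P) * card P)"
      by (intro dvd_mult mult_dvd_mono) auto
    hence "p ^ Suc (multiplicity p (order G)) dvd order G"
      unfolding eq by (simp add: SylD(2)[OF P])
    moreover have "\<not> is_unit p" using p'(1) not_prime_unit by auto
    ultimately show False using power_dvd_iff_le_multiplicity[of "order G" p "Suc (multiplicity p (order G))"] order_pos by auto
  qed
  have nzdvd: "q dvd card (normalizer_of P) \<longleftrightarrow> q dvd order (Syl_quot P) \<or> q = p" if "prime q" for q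
  proof
    assume "q dvd card (normalizer_of P)"
    hence "q dvd order (Syl_quot P) * card P" using order_Syl_quot[OF P] by simp
    hence "q dvd order (Syl_quot P) \<or> q dvd p ^ multiplicity p (order G)"
      using that SylD(2)[OF P] by (simp add: prime_dvd_mult_iff)
    thus "q dvd order (Syl_quot P) \<or> q = p"
      using that p'(1) by (metis prime_dvd_power primes_dvd_imp_eq)
  next
    assume "q dvd order (Syl_quot P) \<or> q = p"
    thus "q dvd card (normalizer_of P)"
      using dvd_card_Syl[OF p P] unfolding order_Syl_quot[OF P, symmetric] by auto
  qed
  have mis: "missing p = {q \<in> prime_factors (order G). \<not> q dvd card (normalizer_of P)}"
    using card_normalizer_of_Syl[OF p'(1) P] by (simp add: missing_def)
  show "\<not> q dvd order (Syl_quot P)" if "q \<in> insert p (missing p)" for q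
    using that np nzdvd unfolding mis by (auto simp: prime_dvd_order)
  have "prime_factors (order G) = prime_factors (order (Syl_quot P)) \<union> insert p (missing p)"
  proof (rule Set.set_eqI)
    fix q
    have "q dvd order G" if "q dvd order (Syl_quot P)"
      using that unfolding eq[symmetric] by simp
    thus "q \<in> prime_factors (order G) \<longleftrightarrow> q \<in> prime_factors (order (Syl_quot P)) \<union> insert p (missing p)"
      using p pos nzdvd[of q] unfolding mis by (auto simp: prime_dvd_order in_prime_factors_iff)
  qed
  moreover have "prime_factors (order (Syl_quot P)) \<inter> insert p (missing p) = {}"
    using np nzdvd unfolding mis by (auto simp: in_prime_factors_iff)
  moreover have "p \<notin> missing p" by (rule self_notin_missing[OF p'])
  moreover have "finite (missing p)" by (simp add: missing_def)
  ultimately show "num_primes G = num_primes (Syl_quot P) + (card (missing p) + 1)"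
    by (simp add: num_primes_def card_Un_disjoint)
qed

lemma finite_missing: "finite (missing p)"
  by (simp add: missing_def)

lemma dvd_card_syl_normal:
  assumes q: "q \<in> prime_factors (order G)" and H: "H \<in> syl_normal q"
  shows "q dvd card H"
proof -
  obtain P where P: "P \<in> Syl q" "P \<subseteq> H" "subgroup H G" using H by (auto simp: syl_normal_def)
  have "card P dvd card H"
    using finite_group.card_subgroup_dvd[OF finite_group_subgroup[OF P(3)]
        subgroup_incl[OF SylD(1)[OF P(1)] P(3,2)]] by (simp add: order_def)
  thus ?thesis using dvd_card_Syl[OF q P(1)] dvd_trans by blast
qed

text \<open>A member of the family of q contains a Sylow q-subgroup, so q divides its order; a
  member of the family of p lies in some N(P), whose order q does not divide.\<close>

lemma syl_normal_disjoint:
  assumes p: "p \<in> prime_factors (order G)" and q: "q \<in> missing p"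
  shows "syl_normal p \<inter> syl_normal q = {}"
proof (rule ccontr)
  assume "syl_normal p \<inter> syl_normal q \<noteq> {}"
  then obtain H where H: "H \<in> syl_normal p" "H \<in> syl_normal q" by blast
  obtain P where P: "P \<in> Syl p" "H \<subseteq> normalizer_of P" "subgroup H G" using H(1) by (auto simp: syl_normal_def)
  have N: "subgroup (normalizer_of P) G" by (rule subgroup_normalizer_of[OF SylD(3)[OF P(1)]])
  have q': "q \<in> prime_factors (order G)" using q by (simp add: missing_def)
  have "card H dvd card (normalizer_of P)"
    using finite_group.card_subgroup_dvd[OF finite_group_subgroup[OF N]
        subgroup_incl[OF P(3) N P(2)]] by (simp add: order_def)
  moreover have "q dvd card H" using dvd_card_syl_normal[OF q' H(2)] .
  ultimately have "q dvd card (normalizer_of P)" using dvd_trans by blast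
  thus False using q card_normalizer_of_Syl[OF _ P(1)] p by (auto simp: missing_def prime_dvd_order)
qed

lemma syl_free_disjoint:
  assumes p: "p \<in> prime_factors (order G)" and q: "q \<in> insert p (missing p)"
  shows "syl_free p \<inter> syl_normal q = {}"
  using dvd_card_syl_normal[of q] p q by (auto simp: syl_free_def missing_def)

lemma finite_syl_normal: "finite (syl_normal p)"
  by (rule finite_subset[OF _ finite_subgroups]) (auto simp: syl_normal_def)

lemma finite_syl_free: "finite (syl_free p)"
  by (rule finite_subset[OF _ finite_subgroups]) (auto simp: syl_free_def)

lemma card_le_num_subgroups:
  assumes "S \<subseteq> {H. subgroup H G}"
  shows "card S \<le> num_subgroups G"
  unfolding num_subgroups_def by (rule card_mono[OF finite_subgroups assms])

end

text \<open>The induction hypothesis, assumed for groups on \<open>nat\<close> only;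
  \<open>tame_smaller\<close> extends it to every type.\<close>

locale tame_below = finite_group G for G (structure) +
  assumes tame_nat: "\<And>K :: nat monoid. group K \<Longrightarrow> finite (carrier K) \<Longrightarrow> order K < order G \<Longrightarrow> tame K"
begin

lemma tame_smaller:
  assumes "group K" "finite (carrier K)" "order K < order G"
  shows "tame K"
proof -
  obtain L :: "nat monoid" where L: "group L" "finite (carrier L)" "K \<cong> L"
    using finite_group_iso_nat[OF assms(1,2)] .
  have "order L < order G" using assms(3) iso_same_card[OF L(3)] by (simp add: order_def)
  thus ?thesis using tame_iso[OF L(3) assms(1) L(1) tame_nat] L by blast
qed

lemma two_power_le_smaller:
  assumes "group K" "finite (carrier K)" "order K < order G"
  shows "2 ^ num_primes K \<le> num_subgroups K"
proof -
  have "1 \<le> subgroup_ratio K" using tame_ge_1[OF tame_smaller[OF assms]] .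
  hence "real (2 ^ num_primes K) \<le> real (num_subgroups K)"
    by (simp add: subgroup_ratio_def field_simps)
  thus ?thesis unfolding of_nat_le_iff .
qed

lemma Syl_quot_smaller:
  assumes p: "p \<in> prime_factors (order G)" and P: "P \<in> Syl p"
  shows "group (Syl_quot P)" "finite (carrier (Syl_quot P))" "order (Syl_quot P) < order G"
proof -
  show "group (Syl_quot P)" by (rule normal.factorgroup_is_group[OF normal_normalizer_of_Syl[OF P]])
  show "finite (carrier (Syl_quot P))"
    using finite_subgroup[OF subgroup_normalizer_of[OF SylD(3)[OF P]]] by (simp add: carrier_FactGroup)
  have p': "prime p" using p by (simp add: prime_dvd_order)
  have eq: "order G = card (Syl p) * order (Syl_quot P) * card P"
    using card_Syl_normalizer_of[OF p' P] unfolding order_Syl_quot[OF P, symmetric] by simp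
  have "card P > 0" using eq order_pos by (auto intro: gr0I)
  hence "card P > 1" using dvd_card_Syl[OF p P] prime_gt_1_nat[OF p']
    by (metis dvd_imp_le less_le_trans)
  have pos: "card (Syl p) * order (Syl_quot P) > 0" using eq order_pos by (auto intro!: gr0I)
  hence "order (Syl_quot P) \<le> card (Syl p) * order (Syl_quot P)" by simp
  also have "\<dots> < card (Syl p) * order (Syl_quot P) * card P"
    using pos \<open>card P > 1\<close> by simp
  finally show "order (Syl_quot P) < order G" unfolding eq .
qed

text \<open>Each of the i quotients has at least 2 to the number of its primes subgroups and has |M|
  + 1 primes fewer than G. Powers of 2 are kept on both sides to stay in the naturals.\<close>

lemma card_syl_normal_ge:
  assumes p: "p \<in> prime_factors (order G)"
  shows "card (Syl p) * 2 ^ num_primes G \<le> card (syl_normal p) * 2 ^ (card (missing p) + 1)"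
proof -
  have p': "prime p" using p by (simp add: prime_dvd_order)
  have "card (Syl p) * 2 ^ num_primes G = (\<Sum>P\<in>Syl p. 2 ^ num_primes (Syl_quot P) * 2 ^ (card (missing p) + 1))"
  proof -
    have "2 ^ num_primes G = 2 ^ num_primes (Syl_quot P) * (2::nat) ^ (card (missing p) + 1)" if "P \<in> Syl p" for P
      using num_primes_Syl_quot(1)[OF p that] by (simp add: power_add)
    hence "(\<Sum>P\<in>Syl p. 2 ^ num_primes G) = (\<Sum>P\<in>Syl p. 2 ^ num_primes (Syl_quot P) * (2::nat) ^ (card (missing p) + 1))"
      by (rule sum.cong[OF refl])
    thus ?thesis by simp
  qed
  also have "\<dots> \<le> (\<Sum>P\<in>Syl p. num_subgroups (Syl_quot P) * 2 ^ (card (missing p) + 1))"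
    by (intro sum_mono mult_right_mono two_power_le_smaller Syl_quot_smaller[OF p]) auto
  also have "\<dots> = card (syl_normal p) * 2 ^ (card (missing p) + 1)"
    by (simp add: card_syl_normal[OF p'] sum_distrib_right)
  finally show ?thesis .
qed

text \<open>A complement of P in N(P) has the order of N(P)/P, which is prime to p and to all
  missing primes. So all its subgroups belong to \<open>syl_free p\<close>, and the induction
  hypothesis counts them.\<close>

lemma card_syl_free_ge:
  assumes p: "p \<in> prime_factors (order G)" and P: "P \<in> Syl p" and cyc: "cyclic_group (Syl_quot P)"
  shows "2 ^ num_primes (Syl_quot P) \<le> card (syl_free p)"
proof -
  have p': "prime p" using p by (simp add: prime_dvd_order)
  have N: "subgroup (normalizer_of P) G" by (rule subgroup_normalizer_of[OF SylD(3)[OF P]])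
  have "\<not> p dvd order (Syl_quot P)" using num_primes_Syl_quot(2)[OF p P] by blast
  hence "coprime (card P) (order (Syl_quot P))"
    using p' SylD(2)[OF P] by (simp add: prime_imp_coprime)
  then obtain K where K: "subgroup K (G\<lparr>carrier := normalizer_of P\<rparr>)" "card K = order (Syl_quot P)"
    using normal.cyclic_Mod_complement[OF normal_normalizer_of_Syl[OF P] _ cyc] finite_subgroup[OF N] by auto
  have K': "subgroup K G" using incl_subgroup[OF N K(1)] .
  interpret K: finite_group "G\<lparr>carrier := K\<rparr>" using K' by (rule finite_group_subgroup)
  have ord: "order (G\<lparr>carrier := K\<rparr>) = order (Syl_quot P)" using K(2) by (simp add: order_def)
  have "2 ^ num_primes (Syl_quot P) \<le> num_subgroups (G\<lparr>carrier := K\<rparr>)"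
    using two_power_le_smaller[OF K.is_group K.finite_carrier] Syl_quot_smaller(3)[OF p P]
    unfolding num_primes_def ord by simp
  also have "\<dots> = card {H. subgroup H G \<and> H \<subseteq> K}"
    by (simp add: num_subgroups_def subgroups_of_subgroup[OF K'])
  also have "\<dots> \<le> card (syl_free p)"
  proof (rule card_mono[OF finite_syl_free], safe)
    fix H assume H: "subgroup H G" "H \<subseteq> K"
    have "card H dvd order (Syl_quot P)"
      using K.card_subgroup_dvd[OF subgroup_incl[OF H(1) K' H(2)]] ord by simp
    thus "H \<in> syl_free p"
      using H(1) num_primes_Syl_quot(2)[OF p P] dvd_trans unfolding syl_free_def by blast
  qed
  finally show ?thesis .
qed

lemma card_syl_normal_free_ge:
  assumes p: "p \<in> prime_factors (order G)" and two: "2 \<le> card (Syl p)"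
  shows "(card (Syl p) + 1) * 2 ^ num_primes G
    \<le> (card (syl_normal p) + card (syl_free p)) * 2 ^ (card (missing p) + 1)"
proof (cases "\<exists>P\<in>Syl p. cyclic_group (Syl_quot P)")
  case True
  then obtain P where P: "P \<in> Syl p" "cyclic_group (Syl_quot P)" by blast
  have "2 ^ num_primes G \<le> card (syl_free p) * 2 ^ (card (missing p) + 1)"
    using card_syl_free_ge[OF p P] by (simp add: num_primes_Syl_quot(1)[OF p P(1)] power_add)
  with card_syl_normal_ge[OF p] show ?thesis by (simp add: algebra_simps)
next
  case False
  have p': "prime p" using p by (simp add: prime_dvd_order)
  let ?M = "2 ^ (card (missing p) + 1) :: nat"
  \<comment> \<open>No quotient is cyclic, so each has ratio at least 3/2; then 3i/2 >= i + 1
    because i >= 2, and \<open>syl_free p\<close> need not contribute.\<close>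
  have "3 * 2 ^ num_primes G \<le> 2 * (num_subgroups (Syl_quot P) * ?M)" if P: "P \<in> Syl p" for P
  proof -
    have "tame (Syl_quot P)" by (rule tame_smaller[OF Syl_quot_smaller[OF p P]])
    hence "3 / 2 \<le> subgroup_ratio (Syl_quot P)" using False P by (auto simp: tame_def)
    hence "3 * 2 ^ num_primes (Syl_quot P) \<le> 2 * real (num_subgroups (Syl_quot P))"
      by (simp add: subgroup_ratio_def field_simps)
    hence "real (3 * 2 ^ num_primes (Syl_quot P)) \<le> real (2 * num_subgroups (Syl_quot P))" by simp
    hence "3 * 2 ^ num_primes (Syl_quot P) \<le> 2 * num_subgroups (Syl_quot P)"
      unfolding of_nat_le_iff .
    thus ?thesis by (simp add: num_primes_Syl_quot(1)[OF p P] power_add)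
  qed
  hence "(\<Sum>P\<in>Syl p. 3 * 2 ^ num_primes G) \<le> (\<Sum>P\<in>Syl p. 2 * (num_subgroups (Syl_quot P) * ?M))"
    by (rule sum_mono)
  hence "card (Syl p) * (3 * 2 ^ num_primes G) \<le> 2 * (card (syl_normal p) * ?M)"
    by (simp add: card_syl_normal[OF p'] sum_distrib_right sum_distrib_left)
  moreover have "2 * 2 ^ num_primes G \<le> card (Syl p) * (2 :: nat) ^ num_primes G"
    using two by simp
  moreover have "(card (Syl p) + 1) * 2 ^ num_primes G = card (Syl p) * 2 ^ num_primes G + (2::nat) ^ num_primes G"
    "card (Syl p) * (3 * 2 ^ num_primes G) = 3 * (card (Syl p) * (2::nat) ^ num_primes G)" by simp_all
  ultimately have "(card (Syl p) + 1) * 2 ^ num_primes G \<le> card (syl_normal p) * ?M"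
    by linarith
  thus ?thesis by (simp add: algebra_simps)
qed

text \<open>The share of the ratio of G that comes from the family of p.\<close>

definition weight :: "nat \<Rightarrow> real" where
  "weight p = card (syl_normal p) / 2 ^ num_primes G"

lemma weight_ge:
  assumes p: "p \<in> prime_factors (order G)"
  shows "card (Syl p) / 2 ^ (card (missing p) + 1) \<le> weight p"
proof -
  have "real (card (Syl p) * 2 ^ num_primes G) \<le> real (card (syl_normal p) * 2 ^ (card (missing p) + 1))"
    using card_syl_normal_ge[OF p] unfolding of_nat_le_iff .
  thus ?thesis by (simp add: weight_def field_simps)
qed

lemma card_syl_normal_free_ratio:
  assumes p: "p \<in> prime_factors (order G)" and two: "2 \<le> card (Syl p)"
  shows "(card (Syl p) + 1) / 2 ^ (card (missing p) + 1)
    \<le> (card (syl_normal p) + card (syl_free p)) / 2 ^ num_primes G"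
proof -
  have "real ((card (Syl p) + 1) * 2 ^ num_primes G)
      \<le> real ((card (syl_normal p) + card (syl_free p)) * 2 ^ (card (missing p) + 1))"
    using card_syl_normal_free_ge[OF assms] unfolding of_nat_le_iff .
  thus ?thesis by (simp add: field_simps)
qed

text \<open>The families of two missing primes may overlap, hence the pairwise assumption. It is
  applied with \<open>Q\<close> empty, with one prime and, once, with {2, 3}.\<close>

lemma ratio_ge_two_missing:
  assumes p: "p \<in> prime_factors (order G)" and two: "2 \<le> card (Syl p)"
    and Q: "Q \<subseteq> missing p" and pw: "pairwise (\<lambda>q r. syl_normal q \<inter> syl_normal r = {}) Q"
  shows "(card (Syl p) + 1) / 2 ^ (card (missing p) + 1) + (\<Sum>q\<in>Q. weight q) \<le> subgroup_ratio G"
proof -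
  have fQ: "finite Q" using Q finite_missing finite_subset by blast
  have "card (syl_normal p \<union> syl_free p \<union> (\<Union>q\<in>Q. syl_normal q)) \<le> num_subgroups G"
    by (rule card_le_num_subgroups) (auto simp: syl_normal_def syl_free_def)
  moreover have "card (syl_normal p \<union> syl_free p \<union> (\<Union>q\<in>Q. syl_normal q))
      = card (syl_normal p) + card (syl_free p) + (\<Sum>q\<in>Q. card (syl_normal q))"
  proof -
    have "card (\<Union>q\<in>Q. syl_normal q) = (\<Sum>q\<in>Q. card (syl_normal q))"
      by (rule card_UN_disjoint[OF fQ]) (use pw finite_syl_normal in \<open>auto simp: pairwise_def\<close>)
    moreover have "syl_normal p \<inter> syl_free p = {}" using syl_free_disjoint[OF p] by blast
    moreover have "(syl_normal p \<union> syl_free p) \<inter> (\<Union>q\<in>Q. syl_normal q) = {}"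
      using syl_free_disjoint[OF p] syl_normal_disjoint[OF p] Q by blast
    ultimately show ?thesis
      by (simp add: card_Un_disjoint finite_syl_normal finite_syl_free fQ)
  qed
  ultimately have "real (card (syl_normal p) + card (syl_free p) + (\<Sum>q\<in>Q. card (syl_normal q)))
      \<le> real (num_subgroups G)"
    unfolding of_nat_le_iff by simp
  hence "real (card (syl_normal p) + card (syl_free p)) + (\<Sum>q\<in>Q. real (card (syl_normal q)))
      \<le> real (num_subgroups G)" by simp
  hence "(card (syl_normal p) + card (syl_free p)) / 2 ^ num_primes G + (\<Sum>q\<in>Q. weight q) \<le> subgroup_ratio G"
    unfolding subgroup_ratio_def weight_def
    by (simp add: divide_right_mono flip: add_divide_distrib sum_divide_distrib)
  thus ?thesis using card_syl_normal_free_ratio[OF p two] by linarith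
qed

end

section \<open>Nonnormal Sylow subgroups in groups of small ratio\<close>

lemma prod_primes_dvd:
  fixes n :: nat
  assumes "finite S" "\<And>q. q \<in> S \<Longrightarrow> prime q \<and> q dvd n"
  shows "\<Prod>S dvd n"
  using assms
proof (induction S rule: finite_induct)
  case (insert q S)
  have "coprime q (\<Prod>S)"
    using insert by (intro prod_coprime_right) (metis insertCI primes_coprime)
  thus ?case using insert by (simp add: divides_mult)
qed simp

lemma two_power_card_le_prod:
  fixes S :: "nat set"
  assumes "finite S" "\<And>q. q \<in> S \<Longrightarrow> 2 \<le> q"
  shows "2 ^ card S \<le> \<Prod>S"
  using prod_mono[of S "\<lambda>_. 2" "\<lambda>q. q"] assms by simp

lemma prime_lt_8:
  assumes "prime (q :: nat)" "q < 8"
  shows "q \<in> {2, 3, 5, 7}"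
proof -
  have "q \<in> {0, 1, 2, 3, 4, 5, 6, 7}" using assms(2) by auto
  moreover have "q \<noteq> 4" "q \<noteq> 6"
    using assms(1) prime_product[of 2 2] prime_product[of 2 3] by auto
  ultimately show ?thesis using prime_gt_1_nat[OF assms(1)] by auto
qed

text \<open>Pure arithmetic: i is a multiple of the product of M, and the bound leaves few
  multiples. For every i that remains, i - 1 is 1 or a prime power, so p, which divides i - 1, is
  determined.\<close>

lemma small_missing_cases:
  fixes i p :: nat
  assumes M: "M \<subseteq> {2, 3, 5, 7}" and i: "\<Prod>M dvd i" "2 \<le> i" "i + 1 < 4 * 2 ^ card M"
    and p: "prime p" "i mod p = 1" "p \<notin> M"
  shows "(M, i, p) \<in> {({2}, 4, 3), ({2}, 6, 5), ({3}, 3, 2), ({3}, 6, 5), ({5}, 5, 2), ({2, 3}, 6, 5),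
    ({2, 3}, 12, 11), ({2, 5}, 10, 3), ({2, 7}, 14, 13), ({2, 3, 5}, 30, 29)}"
proof -
  have "i = i div p * p + 1" using div_mult_mod_eq[of i p] p(2) by simp
  then obtain t where t: "i = t * p + 1" by blast
  have pcases: "p = r" if "i = r ^ n + 1" "prime r" for r n
  proof -
    have "r ^ n = t * p" using that(1) t by simp
    hence "p dvd r ^ n" by (rule dvdI[OF trans[OF _ mult.commute]])
    thus "p = r" using that(2) p(1) by (meson prime_dvd_power primes_dvd_imp_eq)
  qed
  have "i \<noteq> 2" using t prime_gt_1_nat[OF p(1)] by auto
  obtain k where k: "i = \<Prod>M * k" using i(1) by blast
  have k0: "k \<noteq> 0" by (rule notI) (use k i(2) in simp)
  have P: "prime (2::nat)" "prime (3::nat)" "prime (5::nat)"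
    "prime (11::nat)" "prime (13::nat)" "prime (29::nat)" by simp_all
  \<comment> \<open>Four truth values encode M, so that case splitting produces the 16
    subsets.\<close>
  obtain a b c d where abcd: "M = (if d then {7} else {}) \<union> ((if c then {5} else {}) \<union> ((if b then {3} else {})
      \<union> (if a then {2} else {})))"
    by (rule that[of "7 \<in> M" "5 \<in> M" "3 \<in> M" "2 \<in> M"]) (use M in auto)
  consider "M = {}"
    | "M = {2}"
    | "M = {3}"
    | "M = {5}"
    | "M = {7}"
    | "M = {2,3}"
    | "M = {2,5}"
    | "M = {2,7}"
    | "M = {3,5}"
    | "M = {3,7}"
    | "M = {5,7}"
    | "M = {2,3,5}"
    | "M = {2,3,7}"
    | "M = {2,5,7}"
    | "M = {3,5,7}"
    | "M = {2,3,5,7}"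
    unfolding abcd by (cases a; cases b; cases c; cases d) simp_all
  thus ?thesis
  proof cases
    case 1
    have b: "i = 1 * k" "i + 1 < 4" using k i(3) unfolding 1 by simp_all
    have "i = 2" using b i(2) by arith
    thus ?thesis using \<open>i \<noteq> 2\<close> by simp
  next
    case 2
    have b: "i = 2 * k" "i + 1 < 8" using k i(3) unfolding 2 by simp_all
    have "i = 4 \<or> i = 6" using b k0 \<open>i \<noteq> 2\<close> by arith
    thus ?thesis using pcases[of 3 1, OF _ P(2)] pcases[of 5 1, OF _ P(3)] 2 by auto
  next
    case 3
    have b: "i = 3 * k" "i + 1 < 8" using k i(3) unfolding 3 by simp_all
    have "i = 3 \<or> i = 6" using b k0 \<open>i \<noteq> 2\<close> by arith
    thus ?thesis using pcases[of 2 1, OF _ P(1)] pcases[of 5 1, OF _ P(3)] 3 by auto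
  next
    case 4
    have b: "i = 5 * k" "i + 1 < 8" using k i(3) unfolding 4 by simp_all
    have "i = 5" using b k0 \<open>i \<noteq> 2\<close> by arith
    thus ?thesis using pcases[of 2 2, OF _ P(1)] 4 by auto
  next
    case 5
    have b: "i = 7 * k" "i + 1 < 8" using k i(3) unfolding 5 by simp_all
    hence False using k0 by arith
    thus ?thesis ..
  next
    case 6
    have b: "i = 6 * k" "i + 1 < 16" using k i(3) unfolding 6 by simp_all
    have "i = 6 \<or> i = 12" using b k0 \<open>i \<noteq> 2\<close> by arith
    thus ?thesis using pcases[of 5 1, OF _ P(3)] pcases[of 11 1, OF _ P(4)] 6 by auto
  next
    case 7
    have b: "i = 10 * k" "i + 1 < 16" using k i(3) unfolding 7 by simp_all
    have "i = 10" using b k0 \<open>i \<noteq> 2\<close> by arith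
    thus ?thesis using pcases[of 3 2, OF _ P(2)] 7 by auto
  next
    case 8
    have b: "i = 14 * k" "i + 1 < 16" using k i(3) unfolding 8 by simp_all
    have "i = 14" using b k0 \<open>i \<noteq> 2\<close> by arith
    thus ?thesis using pcases[of 13 1, OF _ P(5)] 8 by auto
  next
    case 9
    have b: "i = 15 * k" "i + 1 < 16" using k i(3) unfolding 9 by simp_all
    hence False using k0 by arith
    thus ?thesis ..
  next
    case 10
    have b: "i = 21 * k" "i + 1 < 16" using k i(3) unfolding 10 by simp_all
    hence False using k0 by arith
    thus ?thesis ..
  next
    case 11
    have b: "i = 35 * k" "i + 1 < 16" using k i(3) unfolding 11 by simp_all
    hence False using k0 by arith
    thus ?thesis ..
  next
    case 12
    have b: "i = 30 * k" "i + 1 < 32" using k i(3) unfolding 12 by simp_all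
    have "i = 30" using b k0 \<open>i \<noteq> 2\<close> by arith
    thus ?thesis using pcases[of 29 1, OF _ P(6)] 12 by auto
  next
    case 13
    have b: "i = 42 * k" "i + 1 < 32" using k i(3) unfolding 13 by simp_all
    hence False using k0 by arith
    thus ?thesis ..
  next
    case 14
    have b: "i = 70 * k" "i + 1 < 32" using k i(3) unfolding 14 by simp_all
    hence False using k0 by arith
    thus ?thesis ..
  next
    case 15
    have b: "i = 105 * k" "i + 1 < 32" using k i(3) unfolding 15 by simp_all
    hence False using k0 by arith
    thus ?thesis ..
  next
    case 16
    have b: "i = 210 * k" "i + 1 < 64" using k i(3) unfolding 16 by simp_all
    hence False using k0 by arith
    thus ?thesis ..
  qed
qed

text \<open>The cofactor of d is 1 modulo p as well. If neither factor were 1, both would be at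
  least p + 1.\<close>

lemma dvd_cong_1_cases:
  fixes d i p :: nat
  assumes "d dvd i" "d mod p = 1" "i mod p = 1" "i < (p + 1) * (p + 1)"
  shows "d = 1 \<or> d = i"
proof (rule ccontr)
  assume *: "\<not> (d = 1 \<or> d = i)"
  obtain k where k: "i = d * k" using assms(1) by blast
  have "k mod p = (d * k) mod p" using assms(2) mod_mult_left_eq[of d p k] by simp
  hence "k mod p = 1" using assms(3) k by simp
  have large: "p + 1 \<le> x" if "x mod p = 1" "x \<noteq> 1" for x
  proof (rule ccontr)
    assume "\<not> p + 1 \<le> x"
    hence "x < p \<or> x = p" by linarith
    thus False using that by auto
  qed
  have "(p + 1) * (p + 1) \<le> d * k"
    using * k by (intro mult_le_mono large assms(2) \<open>k mod p = 1\<close>) auto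
  thus False using assms(4) k by simp
qed

context finite_group
begin

lemma missing_prime: "q \<in> missing p \<Longrightarrow> prime q"
  by (auto simp: missing_def)

lemma prod_missing_dvd:
  assumes p: "prime p"
  shows "\<Prod>(missing p) dvd card (Syl p)"
proof (rule prod_primes_dvd[OF finite_missing])
  fix q assume q: "q \<in> missing p"
  have "q \<in> prime_factors (order G)" using q by (simp add: missing_def)
  hence "0 < multiplicity q (order G)" by (simp add: prime_factors_multiplicity)
  hence "q dvd q ^ multiplicity q (order G)" by simp
  thus "prime q \<and> q dvd card (Syl p)"
    using missing_prime[OF q] missing_power_dvd[OF p q] dvd_trans by blast
qed

lemma two_power_missing_le:
  assumes p: "prime p"
  shows "2 ^ card (missing p) \<le> card (Syl p)"
proof -
  have "2 ^ card (missing p) \<le> \<Prod>(missing p)"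
    using finite_missing missing_prime prime_ge_2_nat by (intro two_power_card_le_prod) auto
  also have "\<dots> \<le> card (Syl p)" using prod_missing_dvd[OF p] card_Syl_pos[OF p] by (intro dvd_imp_le)
  finally show ?thesis .
qed

text \<open>If the Sylow q-subgroup were normal, its order would divide i and be 1 modulo p, hence
  equal i by the divisor assumption; but i has the second prime divisor r.\<close>

lemma missing_nonnormal:
  assumes p: "prime p" and q: "q \<in> missing p"
    and div: "\<And>d. d dvd card (Syl p) \<Longrightarrow> d mod p = 1 \<Longrightarrow> d = 1 \<or> d = card (Syl p)"
    and r: "prime r" "r \<noteq> q" "r dvd card (Syl p)"
  shows "2 \<le> card (Syl q)"
proof (rule ccontr)
  have q': "prime q" using missing_prime[OF q] .
  let ?d = "q ^ multiplicity q (order G)"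
  assume "\<not> 2 \<le> card (Syl q)"
  hence "card (Syl q) = 1" using card_Syl_pos[OF q'] by linarith
  hence "?d = 1 \<or> ?d = card (Syl p)"
    using div[OF missing_power_dvd[OF p q] missing_normal_mod[OF p q]] by blast
  moreover have "0 < multiplicity q (order G)"
    using q by (simp add: missing_def prime_factors_multiplicity)
  hence "?d \<noteq> 1" using prime_gt_1_nat[OF q'] by (simp add: nat_power_eq_Suc_0_iff)
  ultimately have "r dvd ?d" using r(3) by simp
  thus False using r(1,2) q' by (meson prime_dvd_power primes_dvd_imp_eq)
qed

end

section \<open>The possible triples (M, i, p)\<close>

context tame_below
begin

text \<open>The product of the missing primes divides i, so i >= 2^|M|.\<close>

lemma weight_ge_half:
  assumes p: "p \<in> prime_factors (order G)"
  shows "1 / 2 \<le> weight p"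
proof -
  have "real (2 ^ card (missing p)) \<le> real (card (Syl p))"
    using two_power_missing_le[of p] p unfolding of_nat_le_iff by (simp add: prime_dvd_order)
  hence "1 / 2 \<le> card (Syl p) / 2 ^ (card (missing p) + 1)" by (simp add: field_simps)
  thus ?thesis using weight_ge[OF p] by linarith
qed

lemma missing_cases:
  assumes s: "subgroup_ratio G < 5 / 2" and p: "p \<in> prime_factors (order G)" and two: "2 \<le> card (Syl p)"
  shows "(missing p, card (Syl p), p) \<in> {({}, 3, 2), ({2}, 4, 3), ({2}, 6, 5), ({3}, 3, 2), ({3}, 6, 5),
    ({5}, 5, 2), ({2, 3}, 6, 5), ({2, 3}, 12, 11), ({2, 5}, 10, 3), ({2, 7}, 14, 13), ({2, 3, 5}, 30, 29)}"
proof -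
  have p': "prime p" "p dvd order G" using p by (auto simp: prime_dvd_order)
  let ?i = "card (Syl p)" and ?m = "card (missing p)"
  show ?thesis
  proof (cases "missing p = {}")
    case True
    \<comment> \<open>The bound i + 1 < 5 leaves i = 2 or 3. As p divides i - 1, only i = 3 with p =
      2 remains.\<close>
    have "(real ?i + 1) / 2 \<le> subgroup_ratio G"
      using ratio_ge_two_missing[OF p two, of "{}"] True by simp
    from le_less_trans[OF this s] have "real ?i < 4" by simp
    hence i: "?i = 2 \<or> ?i = 3" using two by linarith
    have "p \<noteq> 3" "p > 1" using card_Syl_mod[OF p'(1)] i prime_gt_1_nat[OF p'(1)] by auto
    have "p \<le> ?i"
    proof (rule ccontr)
      assume "\<not> p \<le> ?i"
      thus False using card_Syl_mod[OF p'(1)] two by simp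
    qed
    hence "p = 2" using \<open>p \<noteq> 3\<close> \<open>p > 1\<close> i by linarith
    hence "?i = 3" using i card_Syl_mod[OF p'(1)] by auto
    thus ?thesis using \<open>p = 2\<close> True by simp
  next
    case False
    then obtain q where q: "q \<in> missing p" by blast
    \<comment> \<open>Some missing prime contributes at least 1/2, which leaves less than 2 for p;
      this is where i + 1 < 4 2^|M| originates.\<close>
    have "1 / 2 \<le> weight q" by (rule weight_ge_half) (use q in \<open>simp add: missing_def\<close>)
    moreover have "(real ?i + 1) / 2 ^ (?m + 1) + weight q \<le> subgroup_ratio G"
      using ratio_ge_two_missing[OF p two, of "{q}"] q by (simp add: add.commute)
    ultimately have "(real ?i + 1) / 2 ^ (?m + 1) + 1 / 2 \<le> subgroup_ratio G" by linarith
    also note s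
    also have "5 / 2 = 2 + (1 / 2 :: real)" by simp
    finally have "(real ?i + 1) / 2 ^ (?m + 1) < 2" by (rule add_less_imp_less_right)
    hence "real (?i + 1) < real (4 * 2 ^ ?m)" by (simp add: field_simps)
    hence lt: "?i + 1 < 4 * 2 ^ ?m" unfolding of_nat_less_iff .
    \<comment> \<open>With m = |M|, the other missing primes are at least 2, so r 2^(m-1) is at most
      the product of M, hence at most i, hence below 4 2^m = 8 2^(m-1).\<close>
    have "missing p \<subseteq> {2, 3, 5, 7}"
    proof
      fix r assume r: "r \<in> missing p"
      have m: "?m = Suc (card (missing p - {r}))"
        using r finite_missing by (metis card.remove)
      have "r * 2 ^ card (missing p - {r}) \<le> r * \<Prod>(missing p - {r})"
        by (intro mult_left_mono two_power_card_le_prod)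
          (use finite_missing missing_prime prime_ge_2_nat in auto)
      also have "\<dots> = \<Prod>(missing p)" using r finite_missing by (simp add: prod.remove)
      also have "\<dots> \<le> ?i" using prod_missing_dvd[OF p'(1)] card_Syl_pos[OF p'(1)] by (intro dvd_imp_le)
      also have "\<dots> < 8 * 2 ^ card (missing p - {r})" using lt m by simp
      finally have "r < 8" by simp
      thus "r \<in> {2, 3, 5, 7}" using prime_lt_8[OF missing_prime[OF r]] by blast
    qed
    from small_missing_cases[OF this prod_missing_dvd[OF p'(1)] two lt p'(1) card_Syl_mod[OF p'(1)]
        self_notin_missing[OF p']]
    show ?thesis by blast
  qed
qed

text \<open>Read off as the minimum of i / 2^(|M|+1) over the table: 3/4 occurs for ({3}, 3, 2) and
  ({2, 3}, 6, 5), while the entries with p = 3 give 1 and 5/4.\<close>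

lemma weight_nonnormal:
  assumes s: "subgroup_ratio G < 5 / 2" and p: "p \<in> prime_factors (order G)" and two: "2 \<le> card (Syl p)"
  shows "3 / 4 \<le> weight p" "p = 3 \<Longrightarrow> 1 \<le> weight p"
  using missing_cases[OF assms] weight_ge[OF p] by auto

lemma ratio_ge_one_missing:
  assumes p: "p \<in> prime_factors (order G)" and two: "2 \<le> card (Syl p)" and q: "q \<in> missing p"
  shows "(card (Syl p) + 1) / 2 ^ (card (missing p) + 1) + weight q \<le> subgroup_ratio G"
  using ratio_ge_two_missing[OF p two, of "{q}"] q by simp

lemma nonnormal_cases:
  assumes s: "subgroup_ratio G < 5 / 2" and p: "p \<in> prime_factors (order G)" and two: "2 \<le> card (Syl p)"
  shows "(missing p, card (Syl p), p) \<in> {({}, 3, 2), ({2}, 4, 3), ({3}, 3, 2), ({5}, 5, 2)}"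
proof -
  have nonnormal: "2 \<le> card (Syl q)"
    if "p \<in> prime_factors (order G)" "q \<in> missing p" "(card (Syl p), p) \<in> {(6, 5), (12, 11), (10, 3), (14, 13), (30, 29)}"
      "prime r" "r \<noteq> q" "r dvd card (Syl p)" for p q r
  proof (rule missing_nonnormal[OF _ that(2) _ that(4-6)])
    show "prime p" using that(1) by (simp add: prime_dvd_order)
    show "d = 1 \<or> d = card (Syl p)" if "d dvd card (Syl p)" "d mod p = 1" for d
      by (rule dvd_cong_1_cases[OF that card_Syl_mod])
        (use \<open>(card (Syl p), p) \<in> _\<close> \<open>prime p\<close> in auto)
  qed
  have mp: "q \<in> prime_factors (order G)" if "q \<in> missing p" for p q
    using that by (simp add: missing_def)
  have P: "prime (2::nat)" "prime (3::nat)" "prime (5::nat)" "prime (7::nat)" by auto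
  \<comment> \<open>In the listed pairs i has two prime divisors and i < (p+1)^2, so a missing q is
    nonnormal and its weight of at least 3/4, or 1 if q = 3, completes the bound to 5/2.\<close>
  have elim: False
    if "p \<in> prime_factors (order G)" "2 \<le> card (Syl p)" "q \<in> missing p"
      "(card (Syl p), p) \<in> {(6, 5), (12, 11), (10, 3), (14, 13), (30, 29)}"
      "prime r" "r \<noteq> q" "r dvd card (Syl p)"
      "(card (Syl p) + 1) / 2 ^ (card (missing p) + 1) + (if q = 3 then 1 else 3 / 4) \<ge> (5 / 2 :: real)" for p q r
  proof -
    have q2: "2 \<le> card (Syl q)" using nonnormal[OF that(1,3-7)] .
    have "(if q = 3 then 1 else 3 / 4) \<le> weight q"
      using weight_nonnormal[OF s mp[OF that(3)] q2] by auto
    thus False using ratio_ge_one_missing[OF that(1-3)] that(8) s by linarith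
  qed
  have e5: "(missing p, card (Syl p)) \<notin> {({2}, 6), ({3}, 6)}"
    if "p = 5" "p \<in> prime_factors (order G)" "2 \<le> card (Syl p)" for p
  proof
    assume "(missing p, card (Syl p)) \<in> {({2}, 6), ({3}, 6)}"
    then consider "missing p = {2}" "card (Syl p) = 6" | "missing p = {3}" "card (Syl p) = 6" by blast
    thus False
    proof cases
      case 1
      show False by (rule elim[OF that(2,3), of 2 3]) (use 1 that(1) P in simp_all)
    next
      case 2
      show False by (rule elim[OF that(2,3), of 3 2]) (use 2 that(1) P in simp_all)
    qed
  qed
  \<comment> \<open>One missing prime is not enough here: 7/8 + 1 < 5/2. Both are nonnormal, and
    every table entry for p = 3 has 2 among its missing primes, so the families of 2 and 3 are
    disjoint and 7/8 + 3/4 + 1 > 5/2.\<close>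
  have e53: "(missing p, card (Syl p)) \<noteq> ({2, 3}, 6)"
    if p: "p = 5" "p \<in> prime_factors (order G)" "2 \<le> card (Syl p)" for p
  proof
    assume eq: "(missing p, card (Syl p)) = ({2, 3}, 6)"
    have m: "2 \<in> missing p" "3 \<in> missing p" using eq by auto
    have n: "2 \<le> card (Syl 2)" "2 \<le> card (Syl 3)"
      using nonnormal[OF p(2) m(1) _ P(2)] nonnormal[OF p(2) m(2) _ P(1)] eq p(1) by auto
    have "missing 3 = {2} \<or> missing 3 = {2, 5}" using missing_cases[OF s mp[OF m(2)] n(2)] by auto
    hence "2 \<in> missing 3" by blast
    hence dj: "syl_normal 3 \<inter> syl_normal 2 = {}" by (rule syl_normal_disjoint[OF mp[OF m(2)]])
    have "pairwise (\<lambda>q r. syl_normal q \<inter> syl_normal r = {}) {2, 3}"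
      using dj by (auto simp: pairwise_def)
    from ratio_ge_two_missing[OF p(2,3) _ this]
    have "7 / 8 + (weight 2 + weight 3) \<le> subgroup_ratio G" using eq by simp
    moreover have "3 / 4 \<le> weight 2" by (rule weight_nonnormal(1)[OF s mp[OF m(1)] n(1)])
    moreover have "1 \<le> weight 3" by (rule weight_nonnormal(2)[OF s mp[OF m(2)] n(2) refl])
    ultimately show False using s by linarith
  qed
  \<comment> \<open>Here 5 is missing and nonnormal, but all table entries with p = 5 have just been
    excluded.\<close>
  have e3: "(missing p, card (Syl p)) \<noteq> ({2, 5}, 10)"
    if p: "p = 3" "p \<in> prime_factors (order G)" "2 \<le> card (Syl p)" for p
  proof
    assume eq: "(missing p, card (Syl p)) = ({2, 5}, 10)"
    have m: "5 \<in> missing p" using eq by auto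
    have n: "2 \<le> card (Syl 5)" using nonnormal[OF p(2) m _ P(1)] eq p(1) by auto
    have "(missing 5, card (Syl 5)) \<in> {({2}, 6), ({3}, 6), ({2, 3}, 6)}"
      using missing_cases[OF s mp[OF m] n] by simp
    thus False using e5[OF refl mp[OF m] n] e53[OF refl mp[OF m] n] by blast
  qed
  have e11: "(missing p, card (Syl p), p) \<notin> {({2, 3}, 12, 11), ({2, 7}, 14, 13), ({2, 3, 5}, 30, 29)}"
  proof
    assume "(missing p, card (Syl p), p) \<in> {({2, 3}, 12, 11), ({2, 7}, 14, 13), ({2, 3, 5}, 30, 29)}"
    then consider "missing p = {2, 3}" "card (Syl p) = 12" "p = 11" | "missing p = {2, 7}" "card (Syl p) = 14" "p = 13"
      | "missing p = {2, 3, 5}" "card (Syl p) = 30" "p = 29" by blast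
    thus False
    proof cases
      case 1
      show False by (rule elim[OF p two, of 3 2]) (use 1 P in simp_all)
    next
      case 2
      show False by (rule elim[OF p two, of 2 7]) (use 2 P in simp_all)
    next
      case 3
      show False by (rule elim[OF p two, of 2 3]) (use 3 P in simp_all)
    qed
  qed
  show ?thesis
    using missing_cases[OF assms] e5[OF _ p two] e53[OF _ p two] e3[OF _ p two] e11
    by (elim insertE emptyE) auto
qed

end

section \<open>Coprime direct products\<close>

context finite_group
begin

lemma mult_eq_coprime:
  assumes H: "subgroup H G" and K: "subgroup K G" and cop: "coprime (card H) (card K)"
    and "x \<in> H" "y \<in> K" "u \<in> H" "v \<in> K" "x \<otimes> y = u \<otimes> v"
  shows "x = u \<and> y = v"
proof -
  have "group_disjoint_sum G H K"
    by (simp add: group_disjoint_sum_def is_group H K)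
  from group_disjoint_sum.cancel[OF this] card_Int_coprime[OF H K cop]
  have "\<forall>x\<in>H. \<forall>y\<in>K. \<forall>x'\<in>H. \<forall>y'\<in>K. x \<otimes> y = x' \<otimes> y' \<longrightarrow> x = x' \<and> y = y'" by simp
  thus ?thesis using assms(4-8) by simp
qed

lemma card_set_mult_coprime:
  assumes H: "subgroup H G" and K: "subgroup K G" and cop: "coprime (card H) (card K)"
  shows "card (H <#> K) = card H * card K"
proof -
  have "inj_on (\<lambda>(x, y). x \<otimes> y) (H \<times> K)"
    using mult_eq_coprime[OF H K cop] by (auto intro!: inj_onI)
  moreover have "H <#> K = (\<lambda>(x, y). x \<otimes> y) ` (H \<times> K)" by (auto simp: set_mult_def)
  ultimately show ?thesis by (simp add: card_image card_cartesian_product)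
qed

lemma num_primes_mult:
  assumes "subgroup H G" "subgroup K G" "coprime (card H) (card K)" "card H * card K = order G"
  shows "num_primes G = num_primes (G\<lparr>carrier := H\<rparr>) + num_primes (G\<lparr>carrier := K\<rparr>)"
proof -
  have "0 < card H * card K" using assms(4) order_pos by simp
  hence nz: "card H \<noteq> 0" "card K \<noteq> 0" by auto
  have "prime_factors (order G) = prime_factors (card H) \<union> prime_factors (card K)"
    using prime_factors_product[OF nz] assms(4) by simp
  moreover have "prime_factors (card H) \<inter> prime_factors (card K) = {}"
    using assms(3) by (auto simp: in_prime_factors_iff dest: coprime_common_divisor_nat)
  ultimately show ?thesis by (simp add: num_primes_def order_def card_Un_disjoint)
qed

text \<open>Raising \<open>x \<otimes> y\<close> to the power |K| kills y, so x^|K| is in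
  \<open>L\<close>; so is x^|H| = 1, and the exponents are coprime. Symmetrically for y.\<close>

lemma pow_card_comm_mem:
  assumes H: "subgroup H G" and K: "subgroup K G" and cop: "coprime (card H) (card K)"
    and comm: "x \<otimes> y = y \<otimes> x" and xy: "x \<in> H" "y \<in> K" and L: "subgroup L G" "x \<otimes> y \<in> L"
  shows "x \<in> L" "y \<in> L"
proof -
  have G: "x \<in> carrier G" "y \<in> carrier G" using xy H K by (auto simp: subgroup.mem_carrier)
  have mem: "(x \<otimes> y) [^] (n::nat) \<in> L" for n
    using L by (induction n) (auto simp: subgroup.one_closed subgroup.m_closed)
  have eq: "(x \<otimes> y) [^] (n::nat) = x [^] n \<otimes> y [^] n" for n
    using pow_mult_distrib[OF comm G] .
  have "x [^] card K \<in> L"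
    using mem[of "card K"] eq[of "card K"] pow_card_subgroup[OF K xy(2)] G by simp
  moreover have "x [^] card H \<in> L"
    using pow_card_subgroup[OF H xy(1)] subgroup.one_closed[OF L(1)] by simp
  ultimately show "x \<in> L" using pow_coprime_mem[OF L(1) G(1)] cop by blast
  have "y [^] card H \<in> L"
    using mem[of "card H"] eq[of "card H"] pow_card_subgroup[OF H xy(1)] G by simp
  moreover have "y [^] card K \<in> L"
    using pow_card_subgroup[OF K xy(2)] subgroup.one_closed[OF L(1)] by simp
  ultimately show "y \<in> L" using pow_coprime_mem[OF L(1) G(2)] cop by blast
qed

lemma subgroup_set_mult_comm:
  assumes H: "subgroup H G" and K: "subgroup K G" and comm: "\<And>x y. x \<in> H \<Longrightarrow> y \<in> K \<Longrightarrow> x \<otimes> y = y \<otimes> x"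
  shows "subgroup (H <#> K) G"
proof (rule subgroupI)
  have HG: "x \<in> carrier G" if "x \<in> H" for x using H that by (rule subgroup.mem_carrier)
  have KG: "x \<in> carrier G" if "x \<in> K" for x using K that by (rule subgroup.mem_carrier)
  show "H <#> K \<subseteq> carrier G" using HG KG by (auto simp: set_mult_def)
  show "H <#> K \<noteq> {}" using subgroup.one_closed[OF H] subgroup.one_closed[OF K] by (auto simp: set_mult_def)
  show "inv z \<in> H <#> K" if z: "z \<in> H <#> K" for z
  proof -
    obtain x y where xy: "x \<in> H" "y \<in> K" "z = x \<otimes> y" using z by (auto simp: set_mult_def)
    have "inv z = inv x \<otimes> inv y" using xy comm[OF xy(1,2)] HG KG by (simp add: inv_mult_group)
    moreover have "inv x \<in> H" "inv y \<in> K"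
      using xy subgroup.m_inv_closed[OF H] subgroup.m_inv_closed[OF K] by auto
    ultimately show ?thesis unfolding set_mult_def by blast
  qed
  show "z \<otimes> w \<in> H <#> K" if zw: "z \<in> H <#> K" "w \<in> H <#> K" for z w
  proof -
    obtain x y where xy: "x \<in> H" "y \<in> K" "z = x \<otimes> y" using zw(1) by (auto simp: set_mult_def)
    obtain u v where uv: "u \<in> H" "v \<in> K" "w = u \<otimes> v" using zw(2) by (auto simp: set_mult_def)
    note G = HG[OF xy(1)] KG[OF xy(2)] HG[OF uv(1)] KG[OF uv(2)]
    have "z \<otimes> w = x \<otimes> (y \<otimes> u) \<otimes> v" using xy uv G by (simp add: m_assoc)
    also have "\<dots> = x \<otimes> (u \<otimes> y) \<otimes> v" using comm[OF uv(1) xy(2)] by simp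
    also have "\<dots> = (x \<otimes> u) \<otimes> (y \<otimes> v)" using G by (simp add: m_assoc)
    finally have "z \<otimes> w = (x \<otimes> u) \<otimes> (y \<otimes> v)" .
    moreover have "x \<otimes> u \<in> H" "y \<otimes> v \<in> K"
      using xy uv subgroup.m_closed[OF H] subgroup.m_closed[OF K] by auto
    ultimately show ?thesis unfolding set_mult_def by blast
  qed
qed

text \<open>For coprime commuting factors every subgroup \<open>L\<close> is the product of its
  intersections with \<open>H\<close> and \<open>K\<close>, so subgroups correspond to
  pairs.\<close>

lemma num_subgroups_mult:
  assumes H: "subgroup H G" and K: "subgroup K G" and cop: "coprime (card H) (card K)"
    and card: "card H * card K = order G" and comm: "\<And>x y. x \<in> H \<Longrightarrow> y \<in> K \<Longrightarrow> x \<otimes> y = y \<otimes> x"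
  shows "num_subgroups G = num_subgroups (G\<lparr>carrier := H\<rparr>) * num_subgroups (G\<lparr>carrier := K\<rparr>)"
proof -
  let ?SH = "{X. subgroup X G \<and> X \<subseteq> H}" and ?SK = "{Y. subgroup Y G \<and> Y \<subseteq> K}"
  have HKG: "H <#> K = carrier G"
    by (rule card_subset_eq) (use card_set_mult_coprime[OF H K cop] card in
        \<open>simp_all add: order_def subgroup.subset[OF subgroup_set_mult_comm[OF H K comm]]\<close>)
  have "bij_betw (\<lambda>L. (L \<inter> H, L \<inter> K)) {L. subgroup L G} (?SH \<times> ?SK)"
  proof (rule bij_betw_byWitness[where f' = "\<lambda>(X, Y). X <#> Y"])
    show "\<forall>L\<in>{L. subgroup L G}. (case (L \<inter> H, L \<inter> K) of (X, Y) \<Rightarrow> X <#> Y) = L"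
    proof
      fix L assume "L \<in> {L. subgroup L G}"
      hence L: "subgroup L G" by simp
      have "(L \<inter> H) <#> (L \<inter> K) = L"
      proof (intro equalityI subsetI)
        show "x \<in> L" if "x \<in> (L \<inter> H) <#> (L \<inter> K)" for x
          using that L by (auto simp: set_mult_def subgroup.m_closed)
      next
        fix z assume zL: "z \<in> L"
        with L have "z \<in> H <#> K" unfolding HKG by (rule subgroup.mem_carrier)
        then obtain x y where xy: "x \<in> H" "y \<in> K" "z = x \<otimes> y" by (auto simp: set_mult_def)
        have "x \<in> L" "y \<in> L"
          using pow_card_comm_mem[OF H K cop comm[OF xy(1,2)] xy(1,2) L] zL xy(3) by auto
        thus "z \<in> (L \<inter> H) <#> (L \<inter> K)" using xy by (auto simp: set_mult_def)
      qed
      thus "(case (L \<inter> H, L \<inter> K) of (X, Y) \<Rightarrow> X <#> Y) = L" by simp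
    qed
    have int: "x \<in> X \<and> y \<in> Y"
      if XY: "subgroup X G" "X \<subseteq> H" "subgroup Y G" "Y \<subseteq> K" "x \<in> H" "y \<in> K" "x \<otimes> y \<in> X <#> Y" for X Y x y
    proof -
      obtain u v where uv: "u \<in> X" "v \<in> Y" "x \<otimes> y = u \<otimes> v" using XY(7) by (auto simp: set_mult_def)
      have "x = u \<and> y = v"
        using mult_eq_coprime[OF H K cop XY(5,6) _ _ uv(3)] XY(2,4) uv(1,2) by blast
      thus ?thesis using uv by simp
    qed
    show "\<forall>XY\<in>?SH \<times> ?SK. ((case XY of (X, Y) \<Rightarrow> X <#> Y) \<inter> H, (case XY of (X, Y) \<Rightarrow> X <#> Y) \<inter> K) = XY"
    proof
      fix XY assume "XY \<in> ?SH \<times> ?SK"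
      then obtain X Y where XY: "XY = (X, Y)" and X: "subgroup X G" "X \<subseteq> H" and Y: "subgroup Y G" "Y \<subseteq> K"
        by blast
      have o: "\<one> \<in> X" "\<one> \<in> Y" "\<one> \<in> H" "\<one> \<in> K" using X Y H K by (auto simp: subgroup.one_closed)
      have XG: "x \<in> carrier G" if "x \<in> H \<or> x \<in> K" for x using that H K by (auto simp: subgroup.mem_carrier)
      have "(X <#> Y) \<inter> H = X"
      proof (intro equalityI subsetI)
        fix x assume "x \<in> (X <#> Y) \<inter> H"
        thus "x \<in> X" using int[OF X Y _ o(4), of x] XG by simp
      next
        fix x assume "x \<in> X"
        moreover have "x = x \<otimes> \<one>" using X \<open>x \<in> X\<close> XG by auto
        ultimately show "x \<in> (X <#> Y) \<inter> H" using o X unfolding set_mult_def by blast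
      qed
      moreover have "(X <#> Y) \<inter> K = Y"
      proof (intro equalityI subsetI)
        fix x assume "x \<in> (X <#> Y) \<inter> K"
        thus "x \<in> Y" using int[OF X Y o(3), of x] XG by simp
      next
        fix x assume "x \<in> Y"
        moreover have "x = \<one> \<otimes> x" using Y \<open>x \<in> Y\<close> XG by auto
        ultimately show "x \<in> (X <#> Y) \<inter> K" using o Y unfolding set_mult_def by blast
      qed
      ultimately show "((case XY of (X, Y) \<Rightarrow> X <#> Y) \<inter> H, (case XY of (X, Y) \<Rightarrow> X <#> Y) \<inter> K) = XY"
        by (simp add: XY)
    qed
    show "(\<lambda>L. (L \<inter> H, L \<inter> K)) ` {L. subgroup L G} \<subseteq> ?SH \<times> ?SK"
      using H K subgroups_Inter_pair by auto
    show "(\<lambda>(X, Y). X <#> Y) ` (?SH \<times> ?SK) \<subseteq> {L. subgroup L G}"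
    proof (clarsimp)
      fix X Y assume "subgroup X G" "X \<subseteq> H" "subgroup Y G" "Y \<subseteq> K"
      thus "subgroup (X <#> Y) G" using comm by (intro subgroup_set_mult_comm) blast+
    qed
  qed
  from bij_betw_same_card[OF this] show ?thesis
    by (simp add: num_subgroups_def subgroups_of_subgroup[OF H] subgroups_of_subgroup[OF K] card_cartesian_product)
qed

lemma cyclic_group_mult:
  assumes H: "subgroup H G" and K: "subgroup K G" and cop: "coprime (card H) (card K)"
    and card: "card H * card K = order G" and comm: "\<And>x y. x \<in> H \<Longrightarrow> y \<in> K \<Longrightarrow> x \<otimes> y = y \<otimes> x"
    and cyc: "cyclic_group (G\<lparr>carrier := H\<rparr>)" "cyclic_group (G\<lparr>carrier := K\<rparr>)"
  shows "cyclic_group G"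
proof -
  \<comment> \<open>A generator is described by the subgroups of \<open>G\<close> that contain it.
    Then the powers of \<open>x \<otimes> y\<close> form a subgroup containing x and y, hence
    \<open>H\<close> and \<open>K\<close>.\<close>
  have gen: "\<exists>x\<in>X. \<forall>L. subgroup L G \<longrightarrow> x \<in> L \<longrightarrow> X \<subseteq> L"
    if X: "subgroup X G" "cyclic_group (G\<lparr>carrier := X\<rparr>)" for X
  proof -
    interpret X: group "G\<lparr>carrier := X\<rparr>" using X(1) by (rule subgroup_imp_group)
    obtain x where x: "x \<in> X" "X = range (\<lambda>n::int. x [^]\<^bsub>G\<lparr>carrier := X\<rparr>\<^esub> n)"
      using X(2) unfolding X.cyclic_group by auto
    have "X \<subseteq> L" if L: "subgroup L G" "x \<in> L" for L
    proof
      fix z assume "z \<in> X"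
      then obtain n :: int where "z = x [^]\<^bsub>G\<lparr>carrier := X\<rparr>\<^esub> n" using x(2) by blast
      hence "z = x [^] n" using int_pow_consistent[OF X(1) x(1)] by simp
      thus "z \<in> L" using subgroup_int_pow_closed[OF L] by simp
    qed
    thus ?thesis using x(1) by blast
  qed
  obtain x where x: "x \<in> H" "\<And>L. subgroup L G \<Longrightarrow> x \<in> L \<Longrightarrow> H \<subseteq> L" using gen[OF H cyc(1)] by blast
  obtain y where y: "y \<in> K" "\<And>L. subgroup L G \<Longrightarrow> y \<in> L \<Longrightarrow> K \<subseteq> L" using gen[OF K cyc(2)] by blast
  have G: "x \<otimes> y \<in> carrier G" using x y H K by (auto simp: subgroup.mem_carrier)
  let ?L = "range (\<lambda>n::int. (x \<otimes> y) [^] n)"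
  have L: "subgroup ?L G" by (rule subgroup_of_powers[OF G])
  have "x \<otimes> y \<in> ?L" using int_pow_1[OF G] by (metis rangeI)
  hence "x \<in> ?L" "y \<in> ?L"
    using pow_card_comm_mem[OF H K cop comm[OF x(1) y(1)] x(1) y(1) L] by auto
  hence "H \<subseteq> ?L" "K \<subseteq> ?L" using x(2)[OF L] y(2)[OF L] by auto
  have "H <#> K \<subseteq> ?L"
  proof
    fix z assume "z \<in> H <#> K"
    then obtain u v where "u \<in> H" "v \<in> K" "z = u \<otimes> v" by (auto simp: set_mult_def)
    thus "z \<in> ?L" using \<open>H \<subseteq> ?L\<close> \<open>K \<subseteq> ?L\<close> subgroup.m_closed[OF L, of u v] by blast
  qed
  moreover have "H <#> K = carrier G"
    by (rule card_subset_eq) (use card_set_mult_coprime[OF H K cop] card in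
        \<open>simp_all add: order_def subgroup.subset[OF subgroup_set_mult_comm[OF H K comm]]\<close>)
  ultimately have "carrier G = ?L" using subgroup.subset[OF L] by blast
  thus ?thesis unfolding cyclic_group using G by blast
qed

lemma tame_mult:
  assumes H: "subgroup H G" and K: "subgroup K G" and cop: "coprime (card H) (card K)"
    and card: "card H * card K = order G" and comm: "\<And>x y. x \<in> H \<Longrightarrow> y \<in> K \<Longrightarrow> x \<otimes> y = y \<otimes> x"
    and tame: "tame (G\<lparr>carrier := H\<rparr>)" "tame (G\<lparr>carrier := K\<rparr>)"
  shows "tame G"
proof -
  let ?a = "subgroup_ratio (G\<lparr>carrier := H\<rparr>)" and ?b = "subgroup_ratio (G\<lparr>carrier := K\<rparr>)"
  have ratio: "subgroup_ratio G = ?a * ?b"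
    using num_subgroups_mult[OF assms(1-5)] num_primes_mult[OF assms(1-4)]
    by (simp add: subgroup_ratio_def power_add)
  have ge: "1 \<le> ?a" "1 \<le> ?b" using tame tame_ge_1 by auto
  show ?thesis
  proof (cases "?a = 1 \<or> ?b = 1")
    case True
    thus ?thesis
    proof
      assume a: "?a = 1"
      hence "cyclic_group (G\<lparr>carrier := H\<rparr>)" using tame(1) by (auto simp: tame_def)
      thus ?thesis using tame(2) a ratio cyclic_group_mult[OF assms(1-5)] by (auto simp: tame_def)
    next
      assume b: "?b = 1"
      hence "cyclic_group (G\<lparr>carrier := K\<rparr>)" using tame(2) by (auto simp: tame_def)
      thus ?thesis using tame(1) b ratio cyclic_group_mult[OF assms(1-5)] by (auto simp: tame_def)
    qed
  next
    case False
    hence ab: "?a = 3 / 2 \<or> 2 \<le> ?a" "?b = 3 / 2 \<or> 2 \<le> ?b" using tame by (auto simp: tame_def)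
    \<comment> \<open>Both ratios are now at least 3/2: either both equal 3/2, giving 9/4, or one is
      at least 2 and the product is at least 3.\<close>
    have "?a * ?b = 9 / 4 \<or> 5 / 2 \<le> ?a * ?b"
    proof (cases "?a = 3 / 2 \<and> ?b = 3 / 2")
      case False
      hence "3 / 2 * 2 \<le> ?a * ?b \<or> 2 * (3 / 2) \<le> ?a * ?b"
        using ab mult_mono[of "3 / 2" ?a 2 ?b] mult_mono[of 2 ?a "3 / 2" ?b] by auto
      thus ?thesis by auto
    next
      case True
      hence "?a * ?b = 3 / 2 * (3 / 2)" by (simp only:)
      thus ?thesis by simp
    qed
    thus ?thesis using ratio by (auto simp: tame_def)
  qed
qed

lemma normal_Syl_product:
  assumes "finite S" "\<And>q. q \<in> S \<Longrightarrow> prime q \<and> card (Syl q) = 1"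
  shows "\<exists>N. N \<lhd> G \<and> card N = (\<Prod>q\<in>S. q ^ multiplicity q (order G))"
  using assms
proof (induction S rule: finite_induct)
  case empty
  show ?case using one_is_normal by (intro exI[of _ "{\<one>}"]) simp
next
  case (insert q S)
  then obtain N where N: "N \<lhd> G" "card N = (\<Prod>q\<in>S. q ^ multiplicity q (order G))" by blast
  have q: "prime q" "card (Syl q) = 1" using insert.prems by auto
  obtain Q where Q: "Q \<in> Syl q" using Syl_nonempty[OF q(1)] by blast
  have Qn: "Q \<lhd> G" using card_Syl_eq_1_iff[OF q(1) Q] q(2) by simp
  have "coprime q r" if "r \<in> S" for r
    using that insert.prems insert.hyps(2) q(1) by (metis insertCI primes_coprime)
  hence "coprime (card Q) (card N)"
    unfolding SylD(2)[OF Q] N(2) by (intro prod_coprime_right) simp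
  hence "card (Q <#> N) = card Q * card N"
    using card_set_mult_coprime normal_imp_subgroup[OF Qn] normal_imp_subgroup[OF N(1)] by blast
  moreover have "Q <#> N \<lhd> G" by (rule normal_subgroup_set_mult_closed[OF Qn N(1)])
  ultimately show ?case
    using SylD(2)[OF Q] N(2) insert.hyps by auto
qed

text \<open>As r does not divide i, the full r-part of |G| divides |N(P)|. So N(P) contains a Sylow
  r-subgroup of \<open>G\<close>, and \<open>R\<close> is the only one.\<close>

lemma normal_Syl_subset_normalizer_of:
  assumes p: "prime p" "P \<in> Syl p" and r: "prime r" "R \<in> Syl r" "card (Syl r) = 1"
    and nd: "\<not> r dvd card (Syl p)"
  shows "R \<subseteq> normalizer_of P"
proof -
  have N: "subgroup (normalizer_of P) G" by (rule subgroup_normalizer_of[OF SylD(3)[OF p(2)]])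
  interpret N: finite_group "G\<lparr>carrier := normalizer_of P\<rparr>" using N by (rule finite_group_subgroup)
  have "r ^ multiplicity r (order G) dvd card (Syl p) * card (normalizer_of P)"
    using card_Syl_normalizer_of[OF p] multiplicity_dvd by simp
  moreover have "coprime (r ^ multiplicity r (order G)) (card (Syl p))"
    using r(1) nd by (simp add: prime_imp_coprime)
  ultimately have "r ^ multiplicity r (order G) dvd card (normalizer_of P)"
    by (simp add: coprime_dvd_mult_right_iff)
  then obtain m where "order (G\<lparr>carrier := normalizer_of P\<rparr>) = r ^ multiplicity r (order G) * m"
    by (auto simp: order_def)
  from sylow_thm[OF r(1) N.is_group this N.finite_carrier]
  obtain R' where R': "subgroup R' (G\<lparr>carrier := normalizer_of P\<rparr>)" "card R' = r ^ multiplicity r (order G)" by blast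
  have "R' \<in> Syl r" "R' \<subseteq> normalizer_of P"
    using incl_subgroup[OF N R'(1)] R'(2) subgroup.subset[OF R'(1)] by (auto simp: Syl_def)
  moreover have "R' = R" using r(2,3) \<open>R' \<in> Syl r\<close> by (auto simp: card_1_singleton_iff)
  ultimately show ?thesis by simp
qed

end

context tame_below
begin

text \<open>The complement of the normal Sylow subgroup is the product of all other Sylow
  subgroups, of which at most one is not normal.\<close>

lemma tame_if_normal_factor:
  assumes p: "p \<in> prime_factors (order G)"
    and normal: "\<And>q. q \<in> prime_factors (order G) \<Longrightarrow> q \<noteq> p \<Longrightarrow> card (Syl q) = 1"
    and r: "r \<in> prime_factors (order G)" "r \<noteq> p" "\<not> r dvd card (Syl p)"
  shows "tame G"
proof -
  let ?e = "\<lambda>q. q ^ multiplicity q (order G)" and ?S = "prime_factors (order G) - {p, r}"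
  have p': "prime p" and r': "prime r" using p r by (auto simp: prime_dvd_order)
  obtain P where P: "P \<in> Syl p" using Syl_nonempty[OF p'] by blast
  obtain R where R: "R \<in> Syl r" using Syl_nonempty[OF r'] by blast
  have R1: "card (Syl r) = 1" by (rule normal[OF r(1,2)])
  have Rn: "R \<lhd> G" using card_Syl_eq_1_iff[OF r' R] R1 by simp
  have RN: "R \<subseteq> normalizer_of P" by (rule normal_Syl_subset_normalizer_of[OF p' P r' R R1 r(3)])
  have "\<exists>N. N \<lhd> G \<and> card N = (\<Prod>q\<in>?S. ?e q)"
    by (rule normal_Syl_product) (use normal in \<open>auto simp: prime_dvd_order\<close>)
  then obtain N where N: "N \<lhd> G" "card N = (\<Prod>q\<in>?S. ?e q)" by blast
  note sub = SylD(1)[OF P] SylD(1)[OF R] normal_imp_subgroup[OF N(1)]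
  have cop: "coprime (?e q) (\<Prod>q\<in>?S. ?e q)" if "q = p \<or> q = r" for q
    by (rule prod_coprime_right) (use that p' r' in \<open>auto simp: prime_dvd_order intro!: primes_coprime\<close>)
  have copNP: "coprime (card N) (card P)" and copRN: "coprime (card R) (card N)"
    and copRP: "coprime (card R) (card P)"
    using cop p' r' r(2) by (auto simp: N(2) SylD(2)[OF P] SylD(2)[OF R] coprime_commute primes_coprime)
  define H where "H = N <#> P"
  have H: "subgroup H G" unfolding H_def
    using second_isomorphism_grp.normal_set_mult_subgroup[of N G P] N(1) sub(1)
    by (simp add: second_isomorphism_grp_def second_isomorphism_grp_axioms_def)
  have cardH: "card H = card N * card P"
    unfolding H_def by (rule card_set_mult_coprime[OF sub(3,1) copNP])
  have "order G = (\<Prod>q\<in>prime_factors (order G). ?e q)"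
    using prod_prime_factors[of "order G"] order_pos by simp
  also have "\<dots> = ?e r * (?e p * (\<Prod>q\<in>?S. ?e q))"
  proof -
    have "prime_factors (order G) = insert r (insert p ?S)" using p r(1) by blast
    hence "(\<Prod>q\<in>prime_factors (order G). ?e q) = (\<Prod>q\<in>insert r (insert p ?S). ?e q)" by simp
    also have "\<dots> = ?e r * (?e p * (\<Prod>q\<in>?S. ?e q))" using r(2) by simp
    finally show ?thesis .
  qed
  finally have card: "card R * card H = order G"
    by (simp add: cardH N(2) SylD(2)[OF P] SylD(2)[OF R] mult.commute)
  have copRH: "coprime (card R) (card H)" using copRN copRP by (simp add: cardH)
  have commN: "x \<otimes> y = y \<otimes> x" if "x \<in> R" "y \<in> N" for x y
    by (rule normal_imp_commuting[OF Rn N(1) _ that]) (simp add: card_Int_coprime[OF sub(2,3) copRN])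
  \<comment> \<open>\<open>P\<close> need not be normal in \<open>G\<close>, but inside N(P) both
    \<open>P\<close> and \<open>R\<close> are normal, with trivial intersection.\<close>
  have commP: "x \<otimes> y = y \<otimes> x" if "x \<in> R" "y \<in> P" for x y
  proof -
    have nzP: "subgroup (normalizer_of P) G" by (rule subgroup_normalizer_of[OF SylD(3)[OF P]])
    interpret Z: group "G\<lparr>carrier := normalizer_of P\<rparr>" using nzP by (rule subgroup_imp_group)
    have "x \<otimes>\<^bsub>G\<lparr>carrier := normalizer_of P\<rparr>\<^esub> y = y \<otimes>\<^bsub>G\<lparr>carrier := normalizer_of P\<rparr>\<^esub> x"
      by (rule Z.normal_imp_commuting[OF normal_restrict_supergroup[OF nzP Rn RN] normal_normalizer_of_Syl[OF P] _ that])
        (simp add: card_Int_coprime[OF sub(2,1) copRP])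
    thus ?thesis by simp
  qed
  have comm: "x \<otimes> y = y \<otimes> x" if x: "x \<in> R" and y: "y \<in> H" for x y
  proof -
    obtain u v where uv: "u \<in> N" "v \<in> P" "y = u \<otimes> v" using y by (auto simp: H_def set_mult_def)
    have G: "x \<in> carrier G" "u \<in> carrier G" "v \<in> carrier G"
      using x uv sub by (auto simp: subgroup.mem_carrier)
    have "x \<otimes> y = (x \<otimes> u) \<otimes> v" using uv G by (simp add: m_assoc)
    also have "\<dots> = u \<otimes> (x \<otimes> v)" using commN[OF x uv(1)] G by (simp add: m_assoc)
    also have "\<dots> = y \<otimes> x" using commP[OF x uv(2)] uv(3) G by (simp add: m_assoc)
    finally show ?thesis .
  qed
  have gt1: "1 < card X" if "X \<in> Syl q" "q \<in> prime_factors (order G)" for X q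
  proof -
    have "q dvd card X" "card X \<noteq> 0"
      using dvd_card_Syl[OF that(2,1)] finite_subgroup[OF SylD(1)[OF that(1)]] subgroup.one_closed[OF SylD(1)[OF that(1)]]
      by auto
    thus ?thesis using that(2) prime_gt_1_nat[of q] by (auto simp: prime_dvd_order dest: dvd_imp_le)
  qed
  have pos: "0 < card N" "0 < card R" "0 < card P" using card cardH order_pos by (auto intro!: gr0I)
  have "card P \<le> card H" using cardH pos by simp
  hence "1 < card H" using gt1[OF P p] by linarith
  hence "card R < order G" "card H < order G"
    using gt1[OF R r(1)] pos unfolding card[symmetric] by simp_all
  hence "tame (G\<lparr>carrier := R\<rparr>)" "tame (G\<lparr>carrier := H\<rparr>)"
    using sub(2) H finite_subgroup by (auto intro!: tame_smaller subgroup_imp_group simp: order_def)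
  thus ?thesis using tame_mult[OF sub(2) H copRH card comm] by blast
qed

end

section \<open>Groups with few prime divisors\<close>

context finite_group
begin

text \<open>A group of order 2 has only the trivial automorphism, so whatever normalizes
  \<open>E\<close> centralizes it.\<close>

lemma order_two_normalizes:
  assumes E: "subgroup E G" "card E = 2" and P: "P \<subseteq> normalizer_of E"
  shows "E \<subseteq> normalizer_of P"
proof
  fix e assume e: "e \<in> E"
  have eG: "e \<in> carrier G" using E(1) e by (rule subgroup.mem_carrier)
  have PG: "g \<in> carrier G" if "g \<in> P" for g using P that by (auto simp: normalizer_of_def)
  have comm: "e \<otimes> g \<otimes> inv e = g" if g: "g \<in> P" for g
  proof -
    have "g \<otimes> e \<otimes> inv g \<in> E" using P g e by (auto simp: normalizer_of_def conj_set_def)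
    moreover have "x = e" if x: "x \<in> E" "x \<noteq> \<one>" "e \<noteq> \<one>" for x
    proof -
      obtain a b where "E = {a, b}" using E(2) by (auto simp: card_2_iff)
      thus ?thesis using x e subgroup.one_closed[OF E(1)] by auto
    qed
    moreover have "g \<otimes> e \<otimes> inv g = \<one> \<Longrightarrow> e = \<one>"
      using conjugation_is_inj[of g e \<one>] PG[OF g] eG by simp
    ultimately have "g \<otimes> e \<otimes> inv g = e"
      using PG[OF g] by (cases "e = \<one>") auto
    hence "e \<otimes> g = g \<otimes> e" using inv_solve_right'[of e "g \<otimes> e" g] PG[OF g] eG by simp
    thus ?thesis using PG[OF g] eG by (simp add: m_assoc)
  qed
  hence "conj_set e P = P" by (simp add: conj_set_def)
  thus "e \<in> normalizer_of P" using eG by (simp add: normalizer_of_def)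
qed

text \<open>Otherwise \<open>E\<close> would lie in N(P), whose order is odd because 2 is
  missing.\<close>

lemma order_two_not_normalized:
  assumes p: "prime p" and P: "P \<in> Syl p" and m: "2 \<in> missing p"
    and E: "subgroup E G" "card E = 2"
  shows "\<not> P \<subseteq> normalizer_of E"
proof
  assume "P \<subseteq> normalizer_of E"
  hence "E \<subseteq> normalizer_of P" by (rule order_two_normalizes[OF E])
  hence "card E dvd card (normalizer_of P)"
    using finite_group.card_subgroup_dvd[OF finite_group_subgroup[OF subgroup_normalizer_of[OF SylD(3)[OF P]]]
        subgroup_incl[OF E(1) subgroup_normalizer_of[OF SylD(3)[OF P]]]] by (simp add: order_def)
  thus False using m card_normalizer_of_Syl[OF p P] E(2) by (simp add: missing_def)
qed

text \<open>Conjugation permutes \<open>Syl p\<close> and therefore preserves the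
  intersection.\<close>

lemma Int_Syl_normal:
  assumes p: "prime p"
  shows "subgroup (\<Inter>(Syl p)) G" "normalizer_of (\<Inter>(Syl p)) = carrier G"
proof -
  let ?E = "\<Inter>(Syl p)"
  show E: "subgroup ?E G"
    by (rule subgroups_Inter) (use SylD Syl_nonempty[OF p] in auto)
  have sub: "conj_set x ?E \<subseteq> ?E" if x: "x \<in> carrier G" for x
  proof
    fix z assume "z \<in> conj_set x ?E"
    then obtain h where h: "h \<in> ?E" "z = x \<otimes> h \<otimes> inv x" by (auto simp: conj_set_def)
    show "z \<in> ?E"
    proof
      fix S assume S: "S \<in> Syl p"
      have "conj_set (inv x) S \<in> Syl p" using x S by (simp add: conj_set_Syl)
      hence "z \<in> conj_set x (conj_set (inv x) S)" using h unfolding conj_set_def by blast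
      also have "conj_set x (conj_set (inv x) S) = S"
        using conj_set_inv_self[of "inv x" S] x SylD(3)[OF S] by simp
      finally show "z \<in> S" .
    qed
  qed
  have "conj_set x ?E = ?E" if x: "x \<in> carrier G" for x
  proof (rule card_subset_eq[OF finite_subgroup[OF E] sub[OF x]])
    show "card (conj_set x ?E) = card ?E" by (rule card_conj_set[OF x subgroup.subset[OF E]])
  qed
  thus "normalizer_of ?E = carrier G" by (auto simp: normalizer_of_def)
qed

text \<open>The three Sylow 2-subgroups would have order 4 and share a subgroup of order 2; it would be
  normal, hence central, but the normalizer of a Sylow 3-subgroup has odd order.\<close>

lemma not_three_Syl_2_four_Syl_3:
  assumes m2: "missing 2 = {3}" "card (Syl 2) = 3" and m3: "missing 3 = {2}" "card (Syl 3) = 4"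
  shows False
proof -
  have P: "prime (2::nat)" "prime (3::nat)" by simp_all
  have "2 ^ multiplicity 2 (order G) dvd (4::nat)"
    using missing_power_dvd[OF P(2), of 2] m3 by simp
  moreover have "4 dvd (2::nat) ^ multiplicity 2 (order G)"
  proof -
    obtain T where T: "T \<in> Syl 3" using Syl_nonempty[OF P(2)] by blast
    have "4 dvd order G" using card_Syl_normalizer_of[OF P(2) T] m3(2) by (metis dvd_triv_left)
    hence "2 ^ 2 dvd order G" by simp
    hence "2 \<le> multiplicity 2 (order G)"
      using power_dvd_iff_le_multiplicity[of "order G" 2 2] order_pos by simp
    hence "(2::nat) ^ 2 dvd 2 ^ multiplicity 2 (order G)" by (rule le_imp_power_dvd)
    thus ?thesis by simp
  qed
  ultimately have four: "(2::nat) ^ multiplicity 2 (order G) = 4" by (rule dvd_antisym)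
  have c4: "card A = 4" if "A \<in> Syl 2" for A using SylD(2)[OF that] four by simp
  obtain A B C where ABC: "Syl 2 = {A, B, C}" "A \<noteq> B" "A \<noteq> C" "B \<noteq> C"
    using m2(2) by (auto simp: card_3_iff)
  hence mem: "A \<in> Syl 2" "B \<in> Syl 2" "C \<in> Syl 2" by auto
  note SA = SylD[OF mem(1)] and SB = SylD[OF mem(2)] and SC = SylD[OF mem(3)]
  have pow2: "\<exists>k. card D = 2 ^ k" if "subgroup D G" "D \<subseteq> S" "S \<in> Syl 2" for D S
  proof -
    have "card D dvd card S"
      using finite_group.card_subgroup_dvd[OF finite_group_subgroup[OF SylD(1)[OF that(3)]]
          subgroup_incl[OF that(1) SylD(1)[OF that(3)] that(2)]] by (simp add: order_def)
    hence "card D dvd 2 ^ 2" using c4[OF that(3)] by simp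
    thus ?thesis by (metis divides_primepow_nat P(1))
  qed
  \<comment> \<open>\<open>A\<close> fixes itself and permutes {B, C} by conjugation; this is the
    kernel. As a 2-group normalizing \<open>B\<close> and \<open>C\<close> it lies in both, so it is
    the intersection of all three.\<close>
  let ?D = "A \<inter> normalizer_of B"
  have D: "subgroup ?D G" by (rule subgroups_Inter_pair[OF SA(1) subgroup_normalizer_of[OF SB(3)]])
  have DB: "?D \<subseteq> B"
    using Syl_normalized_subset[OF P(1) mem(2) D] pow2[OF D _ mem(1)] by blast
  have AG: "x \<in> carrier G" if "x \<in> A" for x using SA(3) that by blast
  have fixA: "conj_set x A = A" if "x \<in> A" for x using subset_normalizer_of[OF SA(1)] that by (auto simp: normalizer_of_def)
  have inj: "S = T" if "conj_set x S = conj_set x T" "x \<in> A" "S \<in> Syl 2" "T \<in> Syl 2" for x S T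
  proof -
    have "S = conj_set (inv x) (conj_set x S)"
      by (rule conj_set_inv_self[OF AG[OF that(2)] SylD(3)[OF that(3)], symmetric])
    also have "\<dots> = conj_set (inv x) (conj_set x T)" by (simp only: that(1))
    also have "\<dots> = T" by (rule conj_set_inv_self[OF AG[OF that(2)] SylD(3)[OF that(4)]])
    finally show ?thesis .
  qed
  have perm: "conj_set x S \<in> {B, C}" if "x \<in> A" "S \<in> {B, C}" for x S
  proof -
    have "S \<in> Syl 2" "S \<noteq> A" using that(2) mem ABC by auto
    hence "conj_set x S \<in> {A, B, C}" using conj_set_Syl[OF AG[OF that(1)], of S 2] ABC(1) by simp
    moreover have "conj_set x S \<noteq> A"
      using inj[of x S A] fixA[OF that(1)] that(1) \<open>S \<in> Syl 2\<close> \<open>S \<noteq> A\<close> mem(1) by auto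
    ultimately show ?thesis by auto
  qed
  have DC: "?D \<subseteq> C"
  proof -
    have "?D \<subseteq> normalizer_of C"
    proof
      fix x assume x: "x \<in> ?D"
      have "conj_set x B = B" using x by (simp add: normalizer_of_def)
      hence "conj_set x C \<noteq> B" using inj[of x C B] x mem ABC(4) by auto
      hence "conj_set x C = C" using perm[of x C] x by auto
      thus "x \<in> normalizer_of C" using x AG by (simp add: normalizer_of_def)
    qed
    thus ?thesis
      using Syl_normalized_subset[OF P(1) mem(3) D] pow2[OF D _ mem(1)] by blast
  qed
  have DI: "?D = \<Inter>(Syl 2)"
  proof -
    have BB: "B \<subseteq> normalizer_of B" by (rule subset_normalizer_of[OF SB(1)])
    have "?D \<subseteq> A \<inter> (B \<inter> C)" using DB DC by (meson Int_greatest Int_lower1)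
    moreover have "A \<inter> (B \<inter> C) \<subseteq> ?D"
      using BB by (meson Int_greatest Int_lower1 Int_lower2 subset_trans)
    ultimately have "?D = A \<inter> (B \<inter> C)" by (rule equalityI)
    thus ?thesis unfolding ABC(1) by simp
  qed
  have "?D \<noteq> A"
  proof
    assume "?D = A"
    hence "A \<subseteq> B" using DB by simp
    hence "A = B" using c4[OF mem(1)] c4[OF mem(2)] finite_subgroup[OF SB(1)] by (simp add: card_subset_eq)
    thus False using ABC(2) by simp
  qed
  then obtain x where x: "x \<in> A" "x \<notin> ?D" by blast
  have xB: "conj_set x B = C" using perm[of x B] x AG by (auto simp: normalizer_of_def)
  \<comment> \<open>All elements of \<open>A\<close> outside \<open>?D\<close> interchange
    \<open>B\<close> and \<open>C\<close>, so they lie in one coset of \<open>?D\<close>, and |A| is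
    at most twice its size.\<close>
  have "A \<subseteq> ?D \<union> (\<lambda>d. x \<otimes> d) ` ?D"
  proof
    fix y assume y: "y \<in> A"
    show "y \<in> ?D \<union> (\<lambda>d. x \<otimes> d) ` ?D"
    proof (cases "y \<in> ?D")
      case False
      hence yB: "conj_set y B = C" using perm[of y B] y AG by (auto simp: normalizer_of_def)
      have "conj_set (inv x \<otimes> y) B = conj_set (inv x) (conj_set x B)"
        using conj_set_mult[of "inv x" y B] AG[OF x(1)] AG[OF y] SB(3) xB yB by simp
      also have "\<dots> = B" by (rule conj_set_inv_self[OF AG[OF x(1)] SB(3)])
      finally have "inv x \<otimes> y \<in> ?D"
        using x y AG subgroup.m_closed[OF SA(1)] subgroup.m_inv_closed[OF SA(1)] by (auto simp: normalizer_of_def)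
      moreover have "y = x \<otimes> (inv x \<otimes> y)" using AG[OF x(1)] AG[OF y] by (simp flip: m_assoc)
      ultimately show ?thesis by blast
    qed simp
  qed
  hence "card A \<le> card (?D \<union> (\<lambda>d. x \<otimes> d) ` ?D)"
    using finite_subgroup[OF D] by (intro card_mono) auto
  also have "\<dots> \<le> card ?D + card ?D"
    using card_Un_le[of ?D "(\<lambda>d. x \<otimes> d) ` ?D"] card_image_le[OF finite_subgroup[OF D], of "\<lambda>d. x \<otimes> d"]
    by linarith
  finally have "2 \<le> card ?D" using c4[OF mem(1)] by simp
  moreover have "card ?D < 4"
    using psubset_card_mono[OF finite_subgroup[OF SA(1)], of ?D] \<open>?D \<noteq> A\<close> c4[OF mem(1)] by auto
  moreover have "card ?D \<noteq> 3"
  proof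
    assume "card ?D = 3"
    moreover have "card ?D dvd card A"
      using finite_group.card_subgroup_dvd[OF finite_group_subgroup[OF SA(1)] subgroup_incl[OF D SA(1)]]
      by (simp add: order_def)
    ultimately show False using c4[OF mem(1)] by simp
  qed
  ultimately have card2: "card (\<Inter>(Syl 2)) = 2" using DI by simp
  obtain T where T: "T \<in> Syl 3" using Syl_nonempty[OF P(2)] by blast
  show False
    using order_two_not_normalized[OF P(2) T _ Int_Syl_normal(1)[OF P(1)] card2] m3(1)
      Int_Syl_normal(2)[OF P(1)] SylD(3)[OF T] by simp
qed

end

section \<open>Direct counts for one or two prime divisors\<close>

context finite_group
begin

lemma trivial_subgroups: "subgroup {\<one>} G" "subgroup (carrier G) G"
  using triv_subgroup subgroup_self by auto

text \<open>With one prime the ratio is half the number of subgroups, so 2, 3, 4 and at least 5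
  subgroups give the required values. With only two subgroups, any nontrivial element generates
  \<open>G\<close>.\<close>

lemma tame_if_num_primes_le_1:
  assumes "num_primes G \<le> 1"
  shows "tame G"
proof (cases "order G = 1")
  case True
  hence carr: "carrier G = {\<one>}" using order_one_triv_iff by simp
  have "{H. subgroup H G} = {{\<one>}}"
  proof (intro equalityI subsetI)
    fix H assume "H \<in> {H. subgroup H G}"
    hence "H \<subseteq> {\<one>}" "\<one> \<in> H" using subgroup.subset subgroup.one_closed carr by blast+
    thus "H \<in> {{\<one>}}" by blast
  qed (use trivial_subgroups in auto)
  hence "subgroup_ratio G = 1" using True by (simp add: subgroup_ratio_def num_subgroups_def num_primes_def)
  moreover have "cyclic_group G"
    unfolding cyclic_group using carr by (intro bexI[of _ "\<one>"]) auto
  ultimately show ?thesis by (simp add: tame_def)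
next
  case False
  have "prime_factors (order G) \<noteq> {}"
    using False order_pos prime_factor_nat[of "order G"] prime_dvd_order by blast
  hence "num_primes G \<noteq> 0" by (simp add: num_primes_def)
  hence one: "num_primes G = 1" using assms by simp
  have ne: "{\<one>} \<noteq> carrier G" using False order_one_triv_iff by auto
  have sub: "{{\<one>}, carrier G} \<subseteq> {H. subgroup H G}" using trivial_subgroups by auto
  have two: "2 \<le> num_subgroups G"
    using card_le_num_subgroups[OF sub] ne by simp
  have cyc: "cyclic_group G" if "num_subgroups G = 2"
  proof -
    have eq: "{{\<one>}, carrier G} = {H. subgroup H G}"
      by (rule card_subset_eq[OF finite_subgroups sub]) (use that ne in \<open>simp add: num_subgroups_def\<close>)
    obtain x where x: "x \<in> carrier G" "x \<noteq> \<one>" using ne by blast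
    have L: "subgroup (range (\<lambda>n::int. x [^] n)) G" by (rule subgroup_of_powers[OF x(1)])
    have "x [^] (1::int) \<in> range (\<lambda>n::int. x [^] n)" by blast
    hence "range (\<lambda>n::int. x [^] n) \<noteq> {\<one>}" using x int_pow_1[OF x(1)] by auto
    moreover have "range (\<lambda>n::int. x [^] n) \<in> {{\<one>}, carrier G}" unfolding eq using L by simp
    ultimately have "carrier G = range (\<lambda>n::int. x [^] n)" by simp
    thus ?thesis unfolding cyclic_group using x(1) by blast
  qed
  have ratio: "subgroup_ratio G = num_subgroups G / 2" using one by (simp add: subgroup_ratio_def)
  from two consider "num_subgroups G = 2" | "num_subgroups G = 3" | "num_subgroups G = 4" | "5 \<le> num_subgroups G"
    by linarith
  thus ?thesis
  proof cases
    case 1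
    thus ?thesis using ratio cyc by (simp add: tame_def)
  qed (use ratio in \<open>simp_all add: tame_def\<close>)
qed

text \<open>The ratio is a quarter of the count: 6, 8 and 9 give 3/2, 2 and 9/4, and 10 or more give
  at least 5/2. A count of 7 is the gap.\<close>

lemma tame_if_num_subgroups:
  assumes "num_primes G = 2" "num_subgroups G = 6 \<or> 8 \<le> num_subgroups G"
  shows "tame G"
proof -
  have ratio: "subgroup_ratio G = num_subgroups G / 4" using assms(1) by (simp add: subgroup_ratio_def)
  from assms(2) consider "num_subgroups G = 6" | "num_subgroups G = 8" | "num_subgroups G = 9" | "10 \<le> num_subgroups G"
    by linarith
  thus ?thesis by cases (use ratio in \<open>simp_all add: tame_def\<close>)
qed

text \<open>Subgroups of different orders are different, so comparing orders replaces comparing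
  sets.\<close>

lemma card_list_le_num_subgroups:
  assumes "\<And>H. H \<in> set Hs \<Longrightarrow> subgroup H G" "distinct (map card Hs)"
    and "S \<subseteq> {H. subgroup H G}" "\<And>H. H \<in> S \<Longrightarrow> card H \<notin> set (map card Hs)"
  shows "card S + length Hs \<le> num_subgroups G"
proof -
  have "S \<inter> set Hs = {}" using assms(4) by auto
  moreover have "card (set Hs) = length Hs" using assms(2) by (simp add: distinct_card distinct_map)
  ultimately have "card S + length Hs = card (S \<union> set Hs)"
    using finite_subset[OF assms(3) finite_subgroups] by (simp add: card_Un_disjoint)
  also have "\<dots> \<le> num_subgroups G"
    by (rule card_le_num_subgroups) (use assms(1,3) in auto)
  finally show ?thesis .
qed

lemma normal_Syl_missing_power:
  assumes p: "prime p" and q: "q \<in> missing p"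
  shows "1 \<le> multiplicity q (order G)" "q ^ multiplicity q (order G) dvd card (Syl p)"
  using missing_power_dvd[OF p q] q by (auto simp: missing_def prime_factors_multiplicity)

lemma order_two_three:
  assumes "prime_factors (order G) = {2, 3}"
  shows "order G = 2 ^ multiplicity 2 (order G) * 3 ^ multiplicity 3 (order G)"
  using prod_prime_factors[of "order G"] order_pos unfolding assms by simp

text \<open>Sylow 3-subgroups (4), subgroups of order 2 (at least 3), and three more.\<close>

lemma tame_Syl_3_eq_4:
  assumes pf: "prime_factors (order G) = {2, 3}" and m: "missing 3 = {2}" "card (Syl 3) = 4"
    and n: "card (Syl 2) = 1"
  shows "tame G"
proof -
  have P: "prime (2::nat)" "prime (3::nat)" by simp_all
  have two: "2 \<in> missing 3" using m by simp
  let ?a = "multiplicity 2 (order G)" and ?b = "multiplicity 3 (order G)"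
  have b: "1 \<le> ?b" using pf prime_factors_multiplicity[of "order G"] by (auto simp: set_eq_iff Suc_le_eq)
  \<comment> \<open>The Sylow 2-subgroup is normal, so its order is 1 modulo 3 besides dividing 4;
    it is therefore 4.\<close>
  have "2 ^ ?a dvd (4::nat)" "1 \<le> ?a" "2 ^ ?a mod 3 = (1::nat)"
    using normal_Syl_missing_power[OF P(2) two] missing_normal_mod[OF P(2) two n] m(2) by simp_all
  moreover from this have "?a \<le> 2" using power_dvd_imp_le[of 2 ?a 2] by simp
  ultimately have a: "?a = 2" by (cases "?a = 1") auto
  obtain T where T: "T \<in> Syl 3" using Syl_nonempty[OF P(2)] by blast
  obtain Q where Q: "Q \<in> Syl 2" using Syl_nonempty[OF P(1)] by blast
  let ?E = "{D. subgroup D G \<and> card D = 2}"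
  have fin: "finite ?E" using finite_subset[OF _ finite_subgroups, of ?E] by blast
  have TG: "g \<in> carrier G" if "g \<in> T" for g using SylD(3)[OF T] that by blast
  \<comment> \<open>\<open>T\<close> acts on the subgroups of order 2. It fixes none of them, since
    2 is missing for 3, so their positive number is a multiple of 3.\<close>
  have "card ?E mod 3 = card {D \<in> ?E. \<forall>g\<in>T. conj_set g D = D} mod 3"
  proof (rule p_subgroup_fixed_points[OF P(2) SylD(1,2)[OF T] fin])
    show "conj_set g D \<in> ?E" if "g \<in> T" "D \<in> ?E" for g D
    proof -
      have D: "subgroup D G" "card D = 2" using that(2) by auto
      show ?thesis
        using subgroup_conj_set[OF TG[OF that(1)] D(1)] card_conj_set[OF TG[OF that(1)] subgroup.subset[OF D(1)]] D(2) by simp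
    qed
    show "conj_set \<one> D = D" if "D \<in> ?E" for D
      using that by (intro conj_set_one) (auto simp: subgroup.subset)
    show "conj_set (g \<otimes> h) D = conj_set g (conj_set h D)" if "g \<in> T" "h \<in> T" "D \<in> ?E" for g h D
      using that TG by (intro conj_set_mult) (auto simp: subgroup.subset)
  qed
  also have "{D \<in> ?E. \<forall>g\<in>T. conj_set g D = D} = {}"
  proof (rule ccontr)
    assume "{D \<in> ?E. \<forall>g\<in>T. conj_set g D = D} \<noteq> {}"
    then obtain D where D: "subgroup D G" "card D = 2" "\<forall>g\<in>T. conj_set g D = D" by blast
    hence "T \<subseteq> normalizer_of D" using TG by (auto simp: normalizer_of_def)
    thus False using order_two_not_normalized[OF P(2) T two D(1,2)] by blast
  qed
  finally have "3 dvd card ?E" by auto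
  moreover have "card ?E \<noteq> 0"
  proof -
    have "order G = 2 ^ 1 * (2 * 3 ^ ?b)" using order_two_three[OF pf] a by simp
    from sylow_thm[OF P(1) is_group this finite_carrier] show ?thesis using fin by auto
  qed
  ultimately have E3: "3 \<le> card ?E" by (intro dvd_imp_le) auto
  have c3: "card D = 3 ^ ?b" if "D \<in> Syl 3" for D using SylD(2)[OF that] .
  have odd: "odd ((3::nat) ^ ?b)" by simp
  have ge3: "3 \<le> (3::nat) ^ ?b" using power_increasing[OF b, of "3::nat"] by simp
  have disj: "Syl 3 \<inter> ?E = {}"
  proof (rule ccontr)
    assume "Syl 3 \<inter> ?E \<noteq> {}"
    then obtain D where "D \<in> Syl 3" "card D = 2" by blast
    thus False using c3[of D] odd by simp
  qed
  have "card (Syl 3 \<union> ?E) + length [{\<one>}, Q, carrier G] \<le> num_subgroups G"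
  proof (rule card_list_le_num_subgroups)
    have cG: "card (carrier G) = 4 * 3 ^ ?b" using order_two_three[OF pf] a by (simp add: order_def)
    have cQ: "card Q = 4" using SylD(2)[OF Q] a by simp
    show "subgroup H G" if "H \<in> set [{\<one>}, Q, carrier G]" for H
      using that trivial_subgroups SylD(1)[OF Q] by auto
    show "distinct (map card [{\<one>}, Q, carrier G])" using cG cQ ge3 b by simp
    show "Syl 3 \<union> ?E \<subseteq> {H. subgroup H G}" using SylD(1) by blast
    show "card H \<notin> set (map card [{\<one>}, Q, carrier G])" if "H \<in> Syl 3 \<union> ?E" for H
    proof -
      have "card H = 3 ^ ?b \<or> card H = 2" using that c3 by blast
      moreover have "3 ^ ?b \<noteq> (4::nat)"
      proof
        assume "3 ^ ?b = (4::nat)"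
        thus False using odd by simp
      qed
      ultimately show ?thesis using cG cQ ge3 b by auto
    qed
  qed
  hence "10 \<le> num_subgroups G"
    using E3 m(2) disj by (simp add: card_Un_disjoint finite_Syl fin)
  moreover have "num_primes G = 2" by (simp add: num_primes_def pf)
  ultimately show ?thesis by (intro tame_if_num_subgroups) auto
qed

text \<open>The missing prime 3 forces the 3-part of the order to be 3. If the order is 6 there are
  at most 6 subgroups. Otherwise a subgroup D of order 2 is not a Sylow subgroup, and D and QD raise
  the count to 8; so 7 never occurs.\<close>

lemma tame_Syl_2_eq_3:
  assumes pf: "prime_factors (order G) = {2, 3}" and m: "missing 2 = {3}" "card (Syl 2) = 3"
    and n: "card (Syl 3) = 1" and ratio: "3 / 2 \<le> subgroup_ratio G"
  shows "tame G"
proof -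
  have P: "prime (2::nat)" "prime (3::nat)" by simp_all
  have three: "3 \<in> missing 2" using m by simp
  let ?a = "multiplicity 2 (order G)" and ?b = "multiplicity 3 (order G)"
  have np: "num_primes G = 2" by (simp add: num_primes_def pf)
  hence six: "6 \<le> num_subgroups G" using ratio by (simp add: subgroup_ratio_def)
  have a: "1 \<le> ?a" using pf prime_factors_multiplicity[of "order G"] by (auto simp: set_eq_iff Suc_le_eq)
  have "3 ^ ?b dvd (3::nat) ^ 1" "1 \<le> ?b"
    using normal_Syl_missing_power[OF P(1) three] m(2) by simp_all
  hence b: "?b = 1" using power_dvd_imp_le[of 3 ?b 1] by simp
  have ord: "order G = 2 ^ ?a * 3" using order_two_three[OF pf] b by simp
  obtain Q where Q: "Q \<in> Syl 3" using Syl_nonempty[OF P(2)] by blast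
  have cQ: "card Q = 3" using SylD(2)[OF Q] b by simp
  show ?thesis
  proof (cases "?a = 1")
    case True
    have "{H. subgroup H G} \<subseteq> {{\<one>}, carrier G, Q} \<union> Syl 2"
    proof
      fix H assume "H \<in> {H. subgroup H G}"
      hence H: "subgroup H G" by simp
      have "card H dvd 2 * 3" using card_subgroup_dvd[OF H] ord True by simp
      then obtain x y where xy: "x dvd 2" "y dvd 3" "card H = x * y" by (rule dvd_productE)
      have "x = 1 \<or> x = 2" "y = 1 \<or> y = 3"
        using xy(1,2) P by (auto simp: prime_nat_iff)
      then consider "card H = 1" | "card H = 2" | "card H = 3" | "card H = 6" using xy(3) by auto
      thus "H \<in> {{\<one>}, carrier G, Q} \<union> Syl 2"
      proof cases
        case 1
        hence "H = {\<one>}" using subgroup.one_closed[OF H] by (auto simp: card_1_singleton_iff)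
        thus ?thesis by simp
      next
        case 2
        thus ?thesis using H True by (simp add: Syl_def)
      next
        case 3
        hence "H \<in> Syl 3" using H b by (simp add: Syl_def)
        hence "H = Q" using n Q by (auto simp: card_1_singleton_iff)
        thus ?thesis by simp
      next
        case 4
        hence "H = carrier G"
          using ord True by (intro card_subset_eq[OF finite_carrier subgroup.subset[OF H]]) (simp add: order_def)
        thus ?thesis by simp
      qed
    qed
    hence "num_subgroups G \<le> card ({{\<one>}, carrier G, Q} \<union> Syl 2)"
      unfolding num_subgroups_def by (intro card_mono) (simp_all add: finite_Syl)
    also have "\<dots> \<le> card {{\<one>}, carrier G, Q} + card (Syl 2)" by (rule card_Un_le)
    also have "\<dots> \<le> 3 + 3" using card_insert_le_m1[of 3 "{carrier G, Q}" "{\<one>}"] card_insert_le_m1[of 2 "{Q}" "carrier G"] m(2) by simp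
    finally show ?thesis using six np by (intro tame_if_num_subgroups) auto
  next
    case False
    hence a2: "2 \<le> ?a" using a by linarith
    have "order G = 2 ^ 1 * (2 ^ (?a - 1) * 3)"
      using ord a by (cases ?a) simp_all
    from sylow_thm[OF P(1) is_group this finite_carrier]
    obtain D where D: "subgroup D G" "card D = 2" by auto
    have Qn: "Q \<lhd> G" using card_Syl_eq_1_iff[OF P(2) Q] n by simp
    have QD: "subgroup (Q <#> D) G"
      using second_isomorphism_grp.normal_set_mult_subgroup[of Q G D] Qn D(1)
      by (simp add: second_isomorphism_grp_def second_isomorphism_grp_axioms_def)
    have cQD: "card (Q <#> D) = 6"
      using card_set_mult_coprime[OF SylD(1)[OF Q] D(1)] cQ D(2) by simp
    have four: "2 ^ 2 dvd (2::nat) ^ ?a" using a2 by (rule le_imp_power_dvd)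
    hence ge4: "4 \<le> (2::nat) ^ ?a" using dvd_imp_le[of 4 "2 ^ ?a"] by simp
    have "card (Syl 2) + length [{\<one>}, D, Q, Q <#> D, carrier G] \<le> num_subgroups G"
    proof (rule card_list_le_num_subgroups)
      have cG: "card (carrier G) = 2 ^ ?a * 3" using ord by (simp add: order_def)
      show "subgroup H G" if "H \<in> set [{\<one>}, D, Q, Q <#> D, carrier G]" for H
        using that trivial_subgroups SylD(1)[OF Q] D(1) QD by auto
      show "distinct (map card [{\<one>}, D, Q, Q <#> D, carrier G])"
        using cG cQ D(2) cQD ge4 a by simp
      show "Syl 2 \<subseteq> {H. subgroup H G}" using SylD(1) by blast
      show "card H \<notin> set (map card [{\<one>}, D, Q, Q <#> D, carrier G])" if "H \<in> Syl 2" for H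
      proof -
        have "2 ^ ?a \<noteq> (6::nat)"
        proof
          assume "2 ^ ?a = (6::nat)"
          thus False using four by simp
        qed
        thus ?thesis using SylD(2)[OF that] cG cQ D(2) cQD ge4 a by simp
      qed
    qed
    hence "8 \<le> num_subgroups G" using m(2) by simp
    thus ?thesis using np by (intro tame_if_num_subgroups) auto
  qed
qed

end

section \<open>The induction step\<close>

context tame_below
begin

theorem tame: "tame G"
proof (rule ccontr)
  assume nt: "\<not> tame G"
  hence s: "subgroup_ratio G < 5 / 2" by (auto simp: tame_def)
  let ?PF = "prime_factors (order G)"
  have P: "prime (2::nat)" "prime (3::nat)" "prime (5::nat)" by simp_all
  have normal: "card (Syl q) = 1 \<or> 2 \<le> card (Syl q)" if "q \<in> ?PF" for q
    using card_Syl_pos[of q] that by (auto simp: prime_dvd_order)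
  have nonempty: "?PF \<noteq> {}"
    using nt tame_if_num_primes_le_1 by (auto simp: num_primes_def)
  have split: False
    if "p \<in> ?PF" "\<And>q. q \<in> ?PF \<Longrightarrow> q \<noteq> p \<Longrightarrow> card (Syl q) = 1" "r \<in> ?PF" "r \<noteq> p" "\<not> r dvd card (Syl p)" for p r
    using tame_if_normal_factor[OF that] nt by blast
  have not_both: False if "2 \<in> ?PF" "3 \<in> ?PF" "2 \<le> card (Syl 2)" "2 \<le> card (Syl 3)"
  proof -
    have c3: "missing 3 = {2}" "card (Syl 3) = 4" using nonnormal_cases[OF s that(2,4)] by auto
    \<comment> \<open>The term 5/4 is (4 + 1) / 4. The three possibilities for p = 2 give
      \<open>weight 2\<close> at least 3/2, 3/4 and 5/4 in turn, so only missing prime 3 with three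
      Sylow 2-subgroups is left.\<close>
    have "5 / 4 + weight 2 \<le> subgroup_ratio G"
      using ratio_ge_one_missing[OF that(2,4), of 2] c3 by simp
    hence w: "weight 2 < 5 / 4" using s by linarith
    from nonnormal_cases[OF s that(1,3)]
    consider "missing 2 = {}" "card (Syl 2) = 3" | "missing 2 = {3}" "card (Syl 2) = 3"
      | "missing 2 = {5}" "card (Syl 2) = 5" by auto
    thus False
    proof cases
      case 2
      thus False using not_three_Syl_2_four_Syl_3 c3 by blast
    qed (use weight_ge[OF that(1)] w in simp_all)
  qed
  show False
  proof (cases "\<exists>p\<in>?PF. 2 \<le> card (Syl p)")
    case False
    obtain p where p: "p \<in> ?PF" using nonempty by blast
    have n: "card (Syl q) = 1" if "q \<in> ?PF" for q using normal[OF that] False that by blast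
    have "q = p" if "q \<in> ?PF" for q
    proof (rule ccontr)
      assume "q \<noteq> p"
      moreover have "\<not> q dvd card (Syl p)" using n[OF p] that by (auto simp: prime_dvd_order)
      ultimately show False using split[OF p n that] by blast
    qed
    hence "?PF \<subseteq> {p}" by blast
    hence "card ?PF \<le> card {p}" by (rule card_mono[rotated]) simp
    thus False using tame_if_num_primes_le_1 nt by (simp add: num_primes_def)
  next
    case True
    then obtain p where p: "p \<in> ?PF" "2 \<le> card (Syl p)" by blast
    have others: "card (Syl q) = 1" if "q \<in> ?PF" "q \<noteq> p" for q
    proof (rule ccontr)
      assume "card (Syl q) \<noteq> 1"
      hence q: "2 \<le> card (Syl q)" using normal[OF that(1)] by blast
      have "p \<in> {2, 3}" "q \<in> {2, 3}"
        using nonnormal_cases[OF s p] nonnormal_cases[OF s that(1) q] by auto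
      hence "p = 2 \<and> q = 3 \<or> p = 3 \<and> q = 2" using that(2) by auto
      thus False using not_both p that(1) q by blast
    qed
    \<comment> \<open>Any prime not dividing i would split off. Since i is a prime power in each
      remaining triple, exactly one prime besides p is left.\<close>
    have dvd: "q dvd card (Syl p)" if "q \<in> ?PF" "q \<noteq> p" for q
      using split[OF p(1) others that] by blast
    obtain A where A: "A \<in> Syl p" using Syl_nonempty p(1) by (auto simp: prime_dvd_order)
    have pf: "?PF = {p, r}" if "card (Syl p) = r ^ k" "0 < k" "prime r" for r k
    proof -
      have "r dvd card (Syl p)" using that by (simp add: dvd_power)
      moreover have "card (Syl p) dvd order G"
        using card_Syl_normalizer_of[OF _ A] p(1) by (metis dvd_triv_left prime_dvd_order)
      ultimately have "r \<in> ?PF" using that(3) dvd_trans by (simp add: prime_dvd_order)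
      moreover have "q = r" if q: "q \<in> ?PF" "q \<noteq> p" for q
      proof -
        have "q dvd r ^ k" using dvd[OF q] \<open>card (Syl p) = r ^ k\<close> by simp
        moreover have "prime q" using q(1) by (simp add: prime_dvd_order)
        ultimately show ?thesis
          using \<open>prime r\<close> by (meson prime_dvd_power primes_dvd_imp_eq)
      qed
      ultimately show ?thesis using p(1) by blast
    qed
    have ge2: False if "?PF = {p, r}" "p \<noteq> r" "2 \<le> subgroup_ratio G" for r
    proof -
      have np: "num_primes G = 2" using that(1,2) by (simp add: num_primes_def)
      hence "8 \<le> num_subgroups G" using that(3) by (simp add: subgroup_ratio_def)
      thus False using tame_if_num_subgroups[OF np] nt by blast
    qed
    have half: "(card (Syl p) + 1) / 2 ^ (card (missing p) + 1) + 1 / 2 \<le> subgroup_ratio G"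
      if "q \<in> missing p" for q
    proof -
      have "1 / 2 \<le> weight q" by (rule weight_ge_half) (use that in \<open>simp add: missing_def\<close>)
      thus ?thesis using ratio_ge_one_missing[OF p that] by linarith
    qed
    \<comment> \<open>The bounds are (3+1)/2 = 2 for ({}, 3, 2) and (5+1)/4 + 1/2 = 2 for ({5}, 5,
      2), enough with two primes. For ({2}, 4, 3) and ({3}, 3, 2) they are only 7/4 and 3/2, so the
      direct counts take over.\<close>
    from nonnormal_cases[OF s p]
    consider "missing p = {}" "card (Syl p) = 3" "p = 2" | "missing p = {2}" "card (Syl p) = 4" "p = 3"
      | "missing p = {3}" "card (Syl p) = 3" "p = 2" | "missing p = {5}" "card (Syl p) = 5" "p = 2" by auto
    thus False
    proof cases
      case 1
      have "2 \<le> subgroup_ratio G" using ratio_ge_two_missing[OF p, of "{}"] 1 by simp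
      thus False using ge2[OF pf[of 3 1]] 1 P by simp
    next
      case 2
      have "?PF = {2, 3}" using pf[of 2 2] 2 P by auto
      thus False using tame_Syl_3_eq_4 2 others[of 2] nt by simp
    next
      case 3
      have "?PF = {2, 3}" using pf[of 3 1] 3 P by auto
      moreover have "3 / 2 \<le> subgroup_ratio G" using half[of 3] 3 by simp
      ultimately show False using tame_Syl_2_eq_3 3 others[of 3] nt by simp
    next
      case 4
      have "2 \<le> subgroup_ratio G" using half[of 5] 4 by simp
      thus False using ge2[OF pf[of 5 1]] 4 P by simp
    qed
  qed
qed

end

lemma tame_finite_nat_group:
  fixes G :: "nat monoid"
  assumes "group G" "finite (carrier G)"
  shows "tame G"
  using assms
proof (induction "order G" arbitrary: G rule: less_induct)
  case less
  interpret tame_below G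
    using less by (simp add: tame_below_def tame_below_axioms_def finite_group_def finite_group_axioms_def)
  show ?case by (rule tame)
qed

lemma tame_finite_group:
  assumes "group G" "finite (carrier G)"
  shows "tame G"
proof -
  obtain K :: "nat monoid" where K: "group K" "finite (carrier K)" "G \<cong> K"
    using finite_group_iso_nat[OF assms] .
  show ?thesis using tame_iso[OF K(3) assms(1) K(1) tame_finite_nat_group[OF K(1,2)]] .
qed

section \<open>Cyclic groups\<close>

text \<open>For d dividing n the solutions of d x = 0 modulo n form a subgroup of order d. A
  subgroup of order d consists of such solutions by Lagrange, and equal cardinalities make it the
  whole solution set.\<close>

lemma num_subgroups_integer_mod_group:
  assumes "0 < n"
  shows "num_subgroups (integer_mod_group n) = card {d. d dvd n}"
proof -
  let ?Z = "integer_mod_group n"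
  have carr: "carrier ?Z = {0..<int n}" using assms by (simp add: carrier_integer_mod_group)
  interpret Z: finite_group ?Z
    by (simp add: finite_group_def finite_group_axioms_def carr)
  have ord: "order ?Z = n" by (simp add: order_def carr)
  let ?H = "\<lambda>d. {x \<in> carrier ?Z. int n dvd int d * x}"
  have card: "card (?H d) = d" if d: "d dvd n" for d
  proof -
    obtain m where m: "n = d * m" using d by blast
    have pos: "0 < d" "0 < m" using assms m by auto
    have "?H d = (\<lambda>k. int m * int k) ` {..<d}"
    proof (intro equalityI subsetI)
      fix x assume x: "x \<in> ?H d"
      hence "int m dvd x" using m pos by simp
      then obtain k where k: "x = int m * k" by blast
      have "0 \<le> k" using x k pos carr by (simp add: zero_le_mult_iff)
      moreover have "int m * k < int m * int d" using x k m carr by (simp add: mult.commute)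
      hence "k < int d" using pos by simp
      ultimately show "x \<in> (\<lambda>k. int m * int k) ` {..<d}"
        using k by (intro image_eqI[of _ _ "nat k"]) auto
    next
      fix x assume "x \<in> (\<lambda>k. int m * int k) ` {..<d}"
      then obtain k where k: "x = int m * int k" "k < d" by blast
      have "int m * int k < int m * int d" using k(2) pos by simp
      thus "x \<in> ?H d" using k m carr by (simp add: mult.commute mult.left_commute)
    qed
    moreover have "inj_on (\<lambda>k. int m * int k) {..<d}" using pos by (auto simp: inj_on_def)
    ultimately show ?thesis by (simp add: card_image)
  qed
  have sub: "subgroup (?H d) ?Z" for d
  proof (rule Z.subgroupI)
    show "?H d \<noteq> {}" using carr assms by (auto intro!: exI[of _ 0])
    show "inv\<^bsub>?Z\<^esub> x \<in> ?H d" if "x \<in> ?H d" for x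
    proof -
      have "int n dvd int d * - x" using that by simp
      hence "int n dvd int d * ((- x) mod int n)"
        by (simp only: dvd_eq_mod_eq_0 mod_mult_right_eq)
      thus ?thesis using that Z.inv_closed[of x] by simp
    qed
    show "x \<otimes>\<^bsub>?Z\<^esub> y \<in> ?H d" if "x \<in> ?H d" "y \<in> ?H d" for x y
    proof -
      have "int n dvd int d * x + int d * y" using that by simp
      hence "int n dvd int d * ((x + y) mod int n)"
        by (simp only: dvd_eq_mod_eq_0 mod_mult_right_eq distrib_left)
      thus ?thesis using that Z.m_closed[of x y] by simp
    qed
  qed auto
  have "bij_betw ?H {d. d dvd n} {H. subgroup H ?Z}"
  proof (rule bij_betw_byWitness[where f' = card])
    show "\<forall>d\<in>{d. d dvd n}. card (?H d) = d" using card by blast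
    show "\<forall>H\<in>{H. subgroup H ?Z}. ?H (card H) = H"
    proof
      fix H assume "H \<in> {H. subgroup H ?Z}"
      hence H: "subgroup H ?Z" by simp
      have sub: "H \<subseteq> ?H (card H)"
      proof
        fix x assume x: "x \<in> H"
        have xG: "x \<in> carrier ?Z" using H x by (rule subgroup.mem_carrier)
        have "(int (card H) * x) mod int n = 0"
          using Z.pow_card_subgroup[OF H x] by simp
        thus "x \<in> ?H (card H)" using xG by (simp add: dvd_eq_mod_eq_0)
      qed
      have eq: "card H = card (?H (card H))"
        by (rule card[symmetric]) (use Z.card_subgroup_dvd[OF H] ord in simp)
      have "finite (?H (card H))" by (rule finite_subset[OF _ Z.finite_carrier]) blast
      from card_subset_eq[OF this sub eq] show "?H (card H) = H" by (rule sym)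
    qed
    show "?H ` {d. d dvd n} \<subseteq> {H. subgroup H ?Z}" using sub by blast
    show "card ` {H. subgroup H ?Z} \<subseteq> {d. d dvd n}" using Z.card_subgroup_dvd ord by auto
  qed
  from bij_betw_same_card[OF this] show ?thesis by (simp add: num_subgroups_def)
qed

lemma card_divisors_prime_power:
  fixes p :: nat
  assumes "prime p"
  shows "card {d. d dvd p ^ k} = Suc k"
proof -
  have "{d. d dvd p ^ k} = (\<lambda>i. p ^ i) ` {..k}"
    using divides_primepow_nat[OF assms] by auto
  moreover have "inj_on (\<lambda>i. p ^ i) {..k}"
    using prime_gt_1_nat[OF assms] by (auto simp: inj_on_def)
  ultimately show ?thesis by (simp add: card_image)
qed

lemma subgroup_ratio_integer_mod_prime_power:
  assumes p: "prime p" and k: "0 < k"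
  shows "subgroup_ratio (integer_mod_group (p ^ k)) = (k + 1) / 2"
proof -
  have "0 < p ^ k" using prime_gt_0_nat[OF p] by simp
  moreover from this have "order (integer_mod_group (p ^ k)) = p ^ k"
    by (simp add: order_def carrier_integer_mod_group del: of_nat_power)
  moreover have "prime_factors (p ^ k) = {p}"
    using p k by (simp add: prime_factorization_prime_power)
  ultimately show ?thesis
    using num_subgroups_integer_mod_group[of "p ^ k"] card_divisors_prime_power[OF p, of k]
    by (simp add: subgroup_ratio_def num_primes_def)
qed

text \<open>The order is 2^2 times 3^2, and each prime contributes a factor 3/2.\<close>

lemma subgroup_ratio_integer_mod_36: "subgroup_ratio (integer_mod_group 36) = 9 / 4"
proof -
  have "{d. d dvd 36} = {1, 2, 3, 4, 6, 9, 12, 18, 36 :: nat}"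
  proof (intro equalityI subsetI)
    fix d :: nat assume "d \<in> {d. d dvd 36}"
    hence "d dvd 2 ^ 2 * 3 ^ 2" by simp
    then obtain x y where xy: "x dvd 2 ^ 2" "y dvd 3 ^ 2" "d = x * y" by (rule dvd_productE)
    have "\<exists>i\<le>2. x = 2 ^ i" "\<exists>j\<le>2. y = 3 ^ j" using xy(1,2) divides_primepow_nat[of 2 x 2] divides_primepow_nat[of 3 y 2] by auto
    then obtain i j where ij: "i \<le> 2" "j \<le> 2" "d = 2 ^ i * 3 ^ j" using xy(3) by blast
    have "i = 0 \<or> i = 1 \<or> i = 2" "j = 0 \<or> j = 1 \<or> j = 2" using ij(1,2) by linarith+
    thus "d \<in> {1, 2, 3, 4, 6, 9, 12, 18, 36}" using ij(3) by auto
  qed auto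
  hence "num_subgroups (integer_mod_group 36) = 9"
    using num_subgroups_integer_mod_group[of 36] by simp
  moreover have "prime_factors (order (integer_mod_group 36)) = {2, 3}"
  proof -
    have "order (integer_mod_group 36) = 2 ^ 2 * 3 ^ 2"
      by (simp add: order_def carrier_integer_mod_group)
    hence "prime_factors (order (integer_mod_group 36)) = prime_factors (2 ^ 2 * 3 ^ 2 :: nat)"
      by (simp only:)
    also have "\<dots> = prime_factors (2 ^ 2 :: nat) \<union> prime_factors (3 ^ 2)"
      by (rule prime_factors_product) simp_all
    also have "\<dots> = {2, 3}"
      using prime_factorization_prime_power[of "2::nat" 2] prime_factorization_prime_power[of "3::nat" 2] by auto
    finally show ?thesis .
  qed
  ultimately show ?thesis by (simp add: subgroup_ratio_def num_primes_def)
qed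

theorem theorem4p15:
  "(\<forall>G :: ('a, 'b) monoid_scheme.
      group G \<longrightarrow> finite (carrier G) \<longrightarrow>
      1 < subgroup_ratio G \<longrightarrow> subgroup_ratio G < 5 / 2 \<longrightarrow>
      subgroup_ratio G \<in> {3 / 2, 2, 9 / 4}) \<and>
   (\<forall>v \<in> {3 / 2, 2, 9 / 4}. \<exists>G :: int monoid.
      group G \<and> finite (carrier G) \<and> subgroup_ratio G = v)"
proof (intro conjI allI impI)
  fix G :: "('a, 'b) monoid_scheme"
  assume "group G" "finite (carrier G)" "1 < subgroup_ratio G" "subgroup_ratio G < 5 / 2"
  thus "subgroup_ratio G \<in> {3 / 2, 2, 9 / 4}"
    using tame_finite_group[of G] by (auto simp: tame_def)
next
  have witness: "\<exists>G :: int monoid. group G \<and> finite (carrier G) \<and> subgroup_ratio G = v"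
    if "0 < n" "subgroup_ratio (integer_mod_group n) = v" for n v
    using that by (intro exI[of _ "integer_mod_group n"]) (simp add: carrier_integer_mod_group)
  \<comment> \<open>Cyclic groups of order 4 and 8 have chains of 3 and 4 subgroups.\<close>
  have "subgroup_ratio (integer_mod_group (2 ^ 2)) = 3 / 2" "subgroup_ratio (integer_mod_group (2 ^ 3)) = 2"
    using subgroup_ratio_integer_mod_prime_power[of 2 2] subgroup_ratio_integer_mod_prime_power[of 2 3] by simp_all
  thus "\<forall>v \<in> {3 / 2, 2, 9 / 4}. \<exists>G :: int monoid. group G \<and> finite (carrier G) \<and> subgroup_ratio G = v"
    using witness[of "2 ^ 2"] witness[of "2 ^ 3"] witness[OF _ subgroup_ratio_integer_mod_36] by auto
qed

end
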